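(* Let $(\phi_t)$ be a non-elliptic semigroup in $\mathbb D$ with Denjoy-Wolff point $\tau$, Koenigs function $h$ and orthogonal speed $v^o(t)$. (1) Suppose that $h(\mathbb D)\subseteq p+\Pi_\alpha$ for some $\alpha>1$ and $p\in\mathbb C$. Then $$\liminf_{t\to+\infty}\left[v^o(t)-\frac{\alpha}{2(\alpha-1)}t^{1-\frac1\alpha}\right]>-\infty,$$ or, equivalently, there exists $K>0$ such that for all $t\ge0$, $$|\phi_t(0)-\tau|\le K\exp\left(-\frac{\alpha}{\alpha-1}t^{1-\frac1\alpha}\right).$$ (2) Suppose that $p+\Pi_\alpha\subseteq h(\mathbb D)$ for some $\alpha>1$ and $p\in\mathbb C$. Then for any $\epsilon>0$, $$\limsup_{t\to+\infty}\left[v^o(t)-\frac{(1+\epsilon)\alpha}{\alpha-1}t^{1-\frac1\alpha}\right]<+\infty,$$ or, equivalently, there exists $K(\epsilon)>0$ such that for all $t\ge0$, $$|\phi_t(0)-\tau|\ge K(\epsilon)\exp\left(-\frac{2(1+\epsilon)\alpha}{\alpha-1}t^{1-\frac1\alpha}\right).$$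
   Context: For $\alpha>1$, $\Pi_\alpha:=\{z\in\mathbb C:\ \mathrm{Im}\,z>|\mathrm{Re}\,z|^\alpha\}$. Let $\mathbb D=\{z\in\mathbb C:|z|<1\}$. A (continuous) semigroup in $\mathbb D$ is a family $(\phi_t)_{t\ge0}$ of holomorphic self-maps of $\mathbb D$ with $\phi_0=\mathrm{id}$, $\phi_{s+t}=\phi_s\circ\phi_t$, and $t\mapsto\phi_t$ continuous for uniform convergence on compacta. It is non-elliptic if it has no fixed points in $\mathbb D$ (no $z\in\mathbb D$ with $\phi_t(z)=z$ for all $t\geq 0$). In that case there is a unique $\tau\in\partial\mathbb D$, the Denjoy-Wolff point, with $\lim_{t\to+\infty}\phi_t(z)=\tau$ for all $z\in\mathbb D$. A Koenigs function of a non-elliptic semigroup $(\phi_t)$ is a univalent function $h:\mathbb D\to\mathbb C$ such that (i) $h(\phi_t(z))=h(z)+it$ for all $z\in\mathbb D$, $t\ge0$, and (ii) $\bigcup_{t\ge0}(h(\mathbb D)-it)$ is a vertical strip, a vertical half-plane, or $\mathbb C$; it exists and is essentially unique (up to an additive constant). Let $k_{\mathbb D}$ be the hyperbolic distance of $\mathbb D$, normalized by $k_{\mathbb D}(0,z)=\frac12\log\frac{1+|z|}{1-|z|}$. For $z\in\mathbb D$ let $\pi(z)$ be the unique point of the geodesic $(-1,1)\tau$ that is closest to $z$ with respect to $k_{\mathbb D}$. The orthogonal speed of $(\phi_t)$ is $v^o(t):=k_{\mathbb D}(0,\pi(\phi_t(0)))$, $t\ge0$. *)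

theory Defs
  imports "HOL-Complex_Analysis.Complex_Analysis"
begin

definition Pi_region :: "real \<Rightarrow> complex set" where
  "Pi_region \<alpha> = {z. Im z > \<bar>Re z\<bar> powr \<alpha>}"

(* A family is a function on all of real; only its restriction to times t \<ge> 0 and points of the
   unit disc is constrained or used. *)
definition disc_semigroup :: "(real \<Rightarrow> complex \<Rightarrow> complex) \<Rightarrow> bool" where
  "disc_semigroup \<phi> \<longleftrightarrow>
     (\<forall>t\<ge>0. \<phi> t holomorphic_on ball 0 1 \<and> \<phi> t ` ball 0 1 \<subseteq> ball 0 1) \<and>
     (\<forall>z\<in>ball 0 1. \<phi> 0 z = z) \<and>
     (\<forall>s\<ge>0. \<forall>t\<ge>0. \<forall>z\<in>ball 0 1. \<phi> (s + t) z = \<phi> s (\<phi> t z)) \<and>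
     (\<forall>t\<ge>0. \<forall>K. compact K \<and> K \<subseteq> ball 0 1 \<longrightarrow>
        uniform_limit K \<phi> (\<phi> t) (at t within {0..}))"

definition non_elliptic :: "(real \<Rightarrow> complex \<Rightarrow> complex) \<Rightarrow> bool" where
  "non_elliptic \<phi> \<longleftrightarrow> \<not> (\<exists>z\<in>ball 0 1. \<forall>t\<ge>0. \<phi> t z = z)"

definition denjoy_wolff_point :: "(real \<Rightarrow> complex \<Rightarrow> complex) \<Rightarrow> complex \<Rightarrow> bool" where
  "denjoy_wolff_point \<phi> \<tau> \<longleftrightarrow>
     \<tau> \<in> sphere 0 1 \<and> (\<forall>z\<in>ball 0 1. ((\<lambda>t. \<phi> t z) \<longlongrightarrow> \<tau>) at_top)"

definition vertical_strip :: "complex set \<Rightarrow> bool" where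
  "vertical_strip S \<longleftrightarrow> (\<exists>a b. a < b \<and> S = {z. a < Re z \<and> Re z < b})"

definition vertical_half_plane :: "complex set \<Rightarrow> bool" where
  "vertical_half_plane S \<longleftrightarrow> (\<exists>a. S = {z. a < Re z} \<or> S = {z. Re z < a})"

definition koenigs_function ::
    "(real \<Rightarrow> complex \<Rightarrow> complex) \<Rightarrow> (complex \<Rightarrow> complex) \<Rightarrow> bool" where
  "koenigs_function \<phi> h \<longleftrightarrow>
     h holomorphic_on ball 0 1 \<and> inj_on h (ball 0 1) \<and>
     (\<forall>z\<in>ball 0 1. \<forall>t\<ge>0. h (\<phi> t z) = h z + \<i> * of_real t) \<and>
     (let U = (\<Union>t\<in>{0..}. (\<lambda>w. w - \<i> * of_real t) ` h ` ball 0 1) in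
        vertical_strip U \<or> vertical_half_plane U \<or> U = UNIV)"

(* Here Moebius_function 0 w z = (z - w) / (1 - cnj w * z), so that this is the Poincare distance
   of curvature -4. Meaningful for z and w in the unit disc. *)
definition hyperbolic_dist :: "complex \<Rightarrow> complex \<Rightarrow> real" where
  "hyperbolic_dist w z =
     1 / 2 * ln ((1 + norm (Moebius_function 0 w z)) / (1 - norm (Moebius_function 0 w z)))"

lemma hyperbolic_dist_0: "hyperbolic_dist 0 z = 1 / 2 * ln ((1 + norm z) / (1 - norm z))"
  by (simp add: hyperbolic_dist_def Moebius_function_simple)

definition diameter_geodesic :: "complex \<Rightarrow> complex set" where
  "diameter_geodesic \<tau> = (\<lambda>r. of_real r * \<tau>) ` {-1<..<1}"

definition geodesic_projection :: "complex \<Rightarrow> complex \<Rightarrow> complex" where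
  "geodesic_projection \<tau> z =
     (THE w. is_arg_min (hyperbolic_dist z) (\<lambda>u. u \<in> diameter_geodesic \<tau>) w)"

definition orthogonal_speed :: "(real \<Rightarrow> complex \<Rightarrow> complex) \<Rightarrow> complex \<Rightarrow> real \<Rightarrow> real" where
  "orthogonal_speed \<phi> \<tau> t = hyperbolic_dist 0 (geodesic_projection \<tau> (\<phi> t 0))"

end

theory Submission
  imports Defs
begin

text \<open>
  Both halves concern the distance \<open>norm (\<phi> t 0 - \<tau>)\<close>. In the right half-plane model with \<open>\<tau>\<close> at
  infinity, the projection to the geodesic is \<open>W \<mapsto> norm W\<close>, so the orthogonal speed at time \<open>t\<close> is
  \<open>- ln (norm (\<phi> t 0 - \<tau>)) / 2\<close> up to a bounded error
  (\<open>eventually_orthogonal_speed_bounds\<close>), and estimates for either quantity yield estimates for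
  the other. Write \<open>\<beta> = 1 - 1 / \<alpha>\<close>; then \<open>t powr \<beta> / \<beta>\<close> is the integral of \<open>s powr (- 1 / \<alpha>)\<close> over
  \<open>s\<close> from \<open>0\<close> to \<open>t\<close>, and \<open>s powr (1 / \<alpha>)\<close> is half the width of the region at height \<open>s\<close>.

  Suppose that the image of \<open>h\<close> lies in a translate of the region. On the region, rotated so that
  its axis is the positive real axis, the function \<open>z powr \<beta> / \<beta>\<close> differs by at most \<open>1\<close> from its
  value at the point \<open>Re z\<close> of the axis. Its exponential therefore has positive real part, and
  composed with \<open>h\<close> it becomes a holomorphic function \<open>q\<close> on the disc with \<open>Re q > 0\<close> and with
  \<open>Re q\<close> at least a constant times \<open>exp (t powr \<beta> / \<beta>)\<close> on the whole orbit after time \<open>t\<close>. That part of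
  the orbit is a path joining \<open>\<phi> t 0\<close> to the circle, so its harmonic measure seen from \<open>0\<close> is at
  least a constant times \<open>norm (\<phi> t 0 - \<tau>)\<close>. A positive harmonic function cannot be large on so
  large a set: \<open>path_barrier\<close> bounds \<open>exp (t powr \<beta> / \<beta>) * norm (\<phi> t 0 - \<tau>)\<close> by a multiple of
  \<open>Re (q 0)\<close>. The harmonic measure bound is proved by comparison with an explicit function, built
  from a square root that changes sign across the path, together with its reflection in the circle.
  The bound is insensitive to the way in which the path approaches the circle, and this matters
  because orbits may converge to \<open>\<tau>\<close> tangentially.

  Suppose now that the image of \<open>h\<close> contains a translate of the region. Then it contains discs of
  radius \<open>s powr (1 / \<alpha>) / (1 + \<epsilon>)\<close> about the points \<open>h 0 + \<i> * s\<close> for large \<open>s\<close>. The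
  Schwarz-Pick inequality for the inverse of \<open>h\<close> on these discs becomes a differential inequality
  for \<open>1 - (norm (\<phi> s 0))\<^sup>2\<close>, which says that, up to a constant factor, it decays no faster than
  \<open>exp (- 2 * (1 + \<epsilon>) * s powr \<beta> / \<beta>)\<close>, and it is at most \<open>2 * norm (\<phi> s 0 - \<tau>)\<close>.
\<close>

section \<open>Analytic and topological preliminaries\<close>

text \<open>
  For \<open>e > 0\<close>, the points where \<open>norm (F z) > B + e\<close> form an open set whose closure stays
  inside \<open>E\<close>, so the usual maximum principle applies on that set. This
  is the form needed near the Denjoy-Wolff point and along a path, where the comparison function
  has no boundary values.
\<close>

lemma maximum_modulus_limsup:
  fixes F :: "complex \<Rightarrow> complex"
  assumes hol: "F holomorphic_on E" and "open E" "bounded E"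
    and lim: "\<And>\<xi> e. \<xi> \<in> frontier E \<Longrightarrow> e > 0 \<Longrightarrow> \<forall>\<^sub>F z in at \<xi> within E. norm (F z) \<le> B + e"
    and "z \<in> E"
  shows "norm (F z) \<le> B"
proof (rule field_le_epsilon)
  fix e :: real assume "e > 0"
  define S where "S = {z \<in> E. B + e < norm (F z)}"
  have cont: "continuous_on E F"
    using hol by (rule holomorphic_on_imp_continuous_on)
  have "S = E \<inter> (\<lambda>z. norm (F z)) -` {B + e<..}"
    by (auto simp: S_def)
  then have "open S"
    using continuous_open_preimage[OF continuous_on_norm[OF cont] \<open>open E\<close> open_greaterThan] by metis
  have clE: "closure S \<subseteq> E"
  proof
    fix \<xi> assume \<xi>: "\<xi> \<in> closure S"
    show "\<xi> \<in> E"
    proof (rule ccontr)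
      assume "\<xi> \<notin> E"
      have "\<xi> \<in> closure E"
        using \<xi> closure_mono[of S E] by (auto simp: S_def)
      with \<open>\<xi> \<notin> E\<close> have "\<xi> \<in> frontier E"
        by (simp add: frontier_def \<open>open E\<close> interior_open)
      from lim[OF this \<open>e > 0\<close>] obtain d where "d > 0"
        and d: "\<And>z. z \<in> E \<Longrightarrow> z \<noteq> \<xi> \<Longrightarrow> dist z \<xi> < d \<Longrightarrow> norm (F z) \<le> B + e"
        unfolding eventually_at by blast
      obtain z where "z \<in> S" "dist z \<xi> < d"
        using \<xi> \<open>d > 0\<close> closure_approachable by blast
      then show False
        using d[of z] \<open>\<xi> \<notin> E\<close> by (auto simp: S_def)
    qed
  qed
  have "norm (F w) \<le> B + e" if "w \<in> S" for w
  proof (rule maximum_modulus_frontier[OF _ _ _ _ that])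
    show "F holomorphic_on interior S"
      using hol interior_subset[of S] by (auto simp: S_def intro: holomorphic_on_subset)
    show "continuous_on (closure S) F"
      using cont clE continuous_on_subset by blast
    show "bounded S"
      using \<open>bounded E\<close> by (rule bounded_subset) (auto simp: S_def)
    show "norm (F w) \<le> B + e" if "w \<in> frontier S" for w
      using that clE \<open>open S\<close> by (auto simp: frontier_def interior_open S_def)
  qed
  then show "norm (F z) \<le> B + e"
    using \<open>z \<in> E\<close> by (force simp: S_def)
qed

text \<open>
  Sliding the numerator's zero along the path, \<open>s \<mapsto> (z - \<gamma> s) / (z - pathfinish \<gamma>)\<close>, deforms
  the quotient to the constant \<open>1\<close> without ever vanishing at points \<open>z\<close> off the path. Hence the
  quotient has a continuous logarithm there, and so a square root.
\<close>

lemma continuous_sqrt_quotient_off_path: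
  fixes \<gamma> :: "real \<Rightarrow> complex"
  assumes "path \<gamma>" "S \<inter> path_image \<gamma> = {}"
  obtains R where "continuous_on S R"
    "\<And>z. z \<in> S \<Longrightarrow> (R z)\<^sup>2 = (z - pathstart \<gamma>) / (z - pathfinish \<gamma>)"
proof -
  let ?h = "\<lambda>x. (snd x - \<gamma> (fst x)) / (snd x - pathfinish \<gamma>)"
  have mem: "\<gamma> s \<in> path_image \<gamma>" if "s \<in> {0..1}" for s
    using that by (auto simp: path_image_def)
  have nz: "z - \<gamma> s \<noteq> 0" if "z \<in> S" "s \<in> {0..1}" for z s
    using mem[OF that(2)] that(1) assms(2) by auto
  have nz1: "z - pathfinish \<gamma> \<noteq> 0" if "z \<in> S" for z
    using nz[OF that, of 1] by (simp add: pathfinish_def)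
  have c1: "continuous_on ({0..1} \<times> S) (\<lambda>x. \<gamma> (fst x))"
    by (rule continuous_on_compose2[of "{0..1}" \<gamma>])
      (use assms(1) in \<open>auto simp: path_def intro!: continuous_intros\<close>)
  have c: "continuous_on ({0..1} \<times> S) ?h"
    using nz1 by (intro continuous_intros c1) auto
  have "homotopic_with_canon (\<lambda>h. True) S (-{0})
      (\<lambda>z. (z - pathstart \<gamma>) / (z - pathfinish \<gamma>)) (\<lambda>z. 1)"
  proof (subst homotopic_with, simp, intro exI[of _ ?h] conjI ballI)
    show "continuous_map (prod_topology (top_of_set {0..1}) (top_of_set S)) (top_of_set (- {0})) ?h"
      using c nz nz1 by (force simp: Pi_iff)
  qed (use nz1 in \<open>simp_all add: pathstart_def pathfinish_def\<close>)
  then obtain g where g: "continuous_on S g"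
      "\<And>z. z \<in> S \<Longrightarrow> (z - pathstart \<gamma>) / (z - pathfinish \<gamma>) = exp (g z)"
    using inessential_eq_continuous_logarithm[of S "\<lambda>z. (z - pathstart \<gamma>) / (z - pathfinish \<gamma>)"] by blast
  show ?thesis
  proof (rule that[of "\<lambda>z. exp (g z / 2)"])
    show "continuous_on S (\<lambda>z. exp (g z / 2))"
      by (intro continuous_intros g(1)) auto
    show "(exp (g z / 2))\<^sup>2 = (z - pathstart \<gamma>) / (z - pathfinish \<gamma>)" if "z \<in> S" for z
      by (simp add: g(2)[OF that] flip: exp_double)
  qed
qed

lemma holomorphic_on_continuous_sqrt:
  assumes "open S" and cont: "continuous_on S R" and hol: "(\<lambda>z. (R z)\<^sup>2) holomorphic_on S"
    and nz: "\<And>z. z \<in> S \<Longrightarrow> R z \<noteq> (0::complex)"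
  shows "R holomorphic_on S"
proof -
  have "R field_differentiable at z" if "z \<in> S" for z
  proof -
    obtain D where D: "((\<lambda>z. (R z)\<^sup>2) has_field_derivative D) (at z)"
      using holomorphic_on_imp_differentiable_at[OF hol \<open>open S\<close> \<open>z \<in> S\<close>]
      unfolding field_differentiable_def by blast
    have Rz: "isCont R z"
      using cont \<open>open S\<close> that continuous_on_eq_continuous_at by blast
    then have R: "(R \<longlongrightarrow> R z) (at z)" by (simp add: isCont_def)
    have "((\<lambda>w. ((R w)\<^sup>2 - (R z)\<^sup>2) / (w - z) / (R w + R z)) \<longlongrightarrow> D / (R z + R z)) (at z)"
      using D nz[OF that] by (intro tendsto_intros R) (auto simp: has_field_derivative_iff)
    moreover have "\<forall>\<^sub>F w in at z. R w + R z \<noteq> 0"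
    proof -
      have "((\<lambda>w. R w + R z) \<longlongrightarrow> R z + R z) (at z)"
        by (intro tendsto_intros R)
      then show ?thesis
        using nz[OF that] tendsto_imp_eventually_ne[of "\<lambda>w. R w + R z" "R z + R z" "at z" 0] by simp
    qed
    then have "\<forall>\<^sub>F w in at z. ((R w)\<^sup>2 - (R z)\<^sup>2) / (w - z) / (R w + R z) = (R w - R z) / (w - z)"
      by eventually_elim (simp add: power2_eq_square square_diff_square_factored)
    ultimately have "((\<lambda>w. (R w - R z) / (w - z)) \<longlongrightarrow> D / (R z + R z)) (at z)"
      using filterlim_cong by force
    then show ?thesis
      unfolding field_differentiable_def has_field_derivative_iff by blast
  qed
  then show ?thesis
    using \<open>open S\<close> by (simp add: holomorphic_on_open field_differentiable_def)
qed

lemma connected_circle_minus_point: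
  assumes "norm \<tau> = 1"
  shows "connected (sphere 0 1 - {\<tau>::complex})"
proof -
  have "(sphere 0 1 - {\<tau>}) homeomorphic {x::complex. \<i> \<bullet> x = 0}"
    using assms by (intro homeomorphic_punctured_sphere_hyperplane) auto
  moreover have "connected {x::complex. \<i> \<bullet> x = 0}"
    by (intro convex_connected convex_hyperplane)
  ultimately show ?thesis
    using homeomorphic_connectedness by blast
qed

text \<open>
  The set is starlike about \<open>-\<tau>\<close>: a point \<open>z\<close> of the disc sees the diameter from \<open>\<tau>\<close> to \<open>-\<tau>\<close>
  under an angle of at least 90 degrees, so moving from \<open>z\<close> straight towards \<open>-\<tau>\<close> only increases
  the distance to \<open>\<tau>\<close>.
\<close>

lemma connected_cball_minus_ball:
  assumes "norm \<tau> = 1"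
  shows "connected (cball 0 1 - ball (\<tau>::complex) r)"
proof (cases "-\<tau> \<in> cball 0 1 - ball \<tau> r")
  case True
  have "closed_segment (- \<tau>) z \<subseteq> cball 0 1 - ball \<tau> r" if z: "z \<in> cball 0 1 - ball \<tau> r" for z
  proof
    fix w assume "w \<in> closed_segment (-\<tau>) z"
    then have "w \<in> closed_segment z (-\<tau>)"
      by (simp add: closed_segment_commute)
    then obtain u where u: "0 \<le> u" "u \<le> 1" and w: "w = (1 - u) *\<^sub>R z + u *\<^sub>R (-\<tau>)"
      by (auto simp: in_segment)
    have "norm w \<le> 1"
      using convexD_alt[OF convex_cball[of "0::complex" 1], of z "-\<tau>" u] u z assms w by simp
    moreover have "r \<le> norm (w - \<tau>)"
    proof -
      have wt: "w - \<tau> = (z - \<tau>) + u *\<^sub>R (- \<tau> - z)"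
        by (simp add: w algebra_simps)
      have "(z - \<tau>) \<bullet> (- \<tau> - z) = (norm \<tau>)\<^sup>2 - (norm z)\<^sup>2"
        by (simp add: power2_norm_eq_inner inner_diff_left inner_diff_right inner_commute)
      also have "\<dots> \<ge> 0"
        using z assms by (simp add: power_le_one)
      finally have ip: "(z - \<tau>) \<bullet> (- \<tau> - z) \<ge> 0" .
      have "(norm (z - \<tau>))\<^sup>2 \<le> (norm (w - \<tau>))\<^sup>2"
        unfolding wt power2_norm_eq_inner
        using ip u(1) by (simp add: inner_add_left inner_add_right inner_commute)
      then have "norm (z - \<tau>) \<le> norm (w - \<tau>)"
        by (rule power2_le_imp_le) simp
      then show ?thesis using z by (simp add: dist_norm norm_minus_commute)
    qed
    ultimately show "w \<in> cball 0 1 - ball \<tau> r"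
      by (simp add: dist_norm norm_minus_commute)
  qed
  then show ?thesis
    using True by (intro starlike_imp_connected) (unfold starlike_def, blast)
next
  case False
  then have "2 < r"
    using assms by (auto simp: dist_norm)
  have "dist \<tau> z < r" if "norm z \<le> 1" for z
    using norm_triangle_ineq4[of \<tau> z] that assms \<open>2 < r\<close> by (simp add: dist_norm)
  then have empty: "cball 0 1 - ball \<tau> r = {}"
    by auto
  show ?thesis by (simp only: empty connected_empty)
qed

section \<open>A path reaching the circle is an effective barrier\<close>

lemma cayley_norm_le_1:
  assumes "Re r \<ge> 0"
  shows "norm ((r - 1) / (r + 1)) \<le> 1"
proof -
  have "(norm (r - 1))\<^sup>2 \<le> (norm (r + 1))\<^sup>2"
    using assms unfolding cmod_power2 by (simp add: power2_eq_square algebra_simps)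
  then have "norm (r - 1) \<le> norm (r + 1)"
    by (rule power2_le_imp_le) simp
  then show ?thesis
    by (simp add: norm_divide divide_le_eq_1)
qed

text \<open>
  The Cayley transform is unbounded near \<open>r = -1\<close> only; there \<open>r\<^sup>2\<close> is close to \<open>1\<close>, and this is
  what the hypothesis rules out.
\<close>

lemma cayley_norm_le_16:
  fixes r :: complex
  assumes "norm (r\<^sup>2 - 1) > 1 / 2"
  shows "norm ((r - 1) / (r + 1)) \<le> 16"
proof -
  have "(r - 1) * (r + 1) = r\<^sup>2 - 1"
    by algebra
  then have eq: "norm (r - 1) * norm (r + 1) = norm (r\<^sup>2 - 1)"
    by (metis norm_mult)
  have 1: "norm (r - 1) \<le> norm r + 1" 
    using norm_triangle_ineq4[of r 1] by simp
  have 2: "norm r - 1 \<le> norm (r + 1)"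
    using norm_diff_ineq[of r 1] by simp
  have pos: "norm (r + 1) > 0"
    using eq assms by (cases "r + 1 = 0") auto
  have "norm (r - 1) \<le> 16 * norm (r + 1)"
  proof (cases "norm r \<le> 7 / 4")
    case True
    have "norm (r - 1) * norm (r - 1) \<le> 11 / 4 * (11 / 4)"
      using 1 True by (intro mult_mono) auto
    also have "\<dots> \<le> 16 * (norm (r - 1) * norm (r + 1))"
      unfolding eq using assms by simp
    finally have "norm (r - 1) * norm (r - 1) \<le> norm (r - 1) * (16 * norm (r + 1))"
      by (simp add: mult_ac)
    moreover have "norm (r - 1) > 0"
      using eq assms by (cases "r - 1 = 0") auto
    ultimately show ?thesis
      by simp
  next
    case False
    then show ?thesis using 1 2 by simp
  qed
  then show ?thesis
    using pos by (simp add: norm_divide divide_le_eq)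
qed

text \<open>
  A lower bound, proportional to \<open>d\<close>, for the harmonic measure at \<open>0\<close> of a path of size \<open>d\<close> that
  ends on the circle. Such a bound follows from any bounded harmonic function on the disc minus
  the path that vanishes on the circle and has size about \<open>d\<close> at \<open>0\<close>, since \<open>Re f\<close> dominates a
  multiple of it by the maximum principle. Here is an explicit one. Let \<open>z1\<close> be the first point of
  the path and let \<open>R\<close> be the square root of \<open>(z - z1) / (z - \<tau>)\<close> off the path. The Cayley
  transform \<open>Y = (R - 1) / (R + 1)\<close> is bounded, and of size at least \<open>d / 4\<close> at \<open>0\<close>. On the circle
  \<open>R\<close> is the complex conjugate of \<open>Q\<close>, the principal square root of the reflected quotient
  \<open>(1 - cnj z1 * z) / (1 - cnj \<tau> * z)\<close>, which is holomorphic in the whole disc and equals \<open>1\<close> at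
  \<open>0\<close>. So if \<open>Z\<close> is the Cayley transform of \<open>Q\<close>, then the real part of \<open>a * Y - cnj a * Z\<close> is
  bounded by \<open>16 + 1\<close>, vanishes on the circle, and for a suitable unimodular \<open>a\<close> equals
  \<open>norm (Y 0)\<close> at \<open>0\<close>. The constant \<open>68\<close> is \<open>4 * 17\<close>.

  That the path starts at its point farthest from \<open>\<tau>\<close> is used to bound \<open>Y\<close>: it keeps
  the points at distance at least \<open>2 * d\<close> from \<open>\<tau>\<close> off the path.
\<close>

lemma path_barrier_from_farthest_point:
  fixes f :: "complex \<Rightarrow> complex"
  assumes holf: "f holomorphic_on ball 0 1"
    and pos: "\<And>z. z \<in> ball 0 1 \<Longrightarrow> Re (f z) > 0"
    and \<tau>: "norm \<tau> = 1"
    and \<gamma>: "path \<gamma>" "pathfinish \<gamma> = \<tau>" "path_image \<gamma> \<subseteq> insert \<tau> (ball 0 1)"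
    and far: "path_image \<gamma> \<subseteq> cball \<tau> (norm (pathstart \<gamma> - \<tau>))"
    and A: "A > 0" "\<And>z. z \<in> path_image \<gamma> - {\<tau>} \<Longrightarrow> A \<le> Re (f z)"
  shows "A * norm (pathstart \<gamma> - \<tau>) \<le> 68 * Re (f 0)"
proof -
  define z1 where "z1 = pathstart \<gamma>"
  define d where "d = norm (z1 - \<tau>)"
  define T where "T = path_image \<gamma>"
  have z1T: "z1 \<in> T" by (simp add: z1_def T_def pathstart_in_path_image)
  have \<tau>T: "\<tau> \<in> T" using \<gamma>(2) pathfinish_in_path_image T_def by blast
  have f0: "Re (f 0) > 0" using pos by simp
  have TD: "norm z < 1" if "z \<in> T" "z \<noteq> \<tau>" for z
    using \<gamma>(3) that by (auto simp: T_def)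
  show ?thesis
  proof (cases "z1 = \<tau> \<or> 0 \<in> T")
    case True
    show ?thesis
    proof (cases "z1 = \<tau>")
      case True
      then show ?thesis using f0 by (simp add: z1_def)
    next
      case False
      have "0 \<noteq> \<tau>" using \<tau> by auto
      then have "A \<le> Re (f 0)" using A(2)[of 0] True False by (simp add: T_def)
      moreover have "norm (z1 - \<tau>) \<le> 2"
        using norm_triangle_ineq4[of z1 \<tau>] TD[OF z1T False] \<tau> by simp
      ultimately have "A * norm (z1 - \<tau>) \<le> Re (f 0) * 2"
        using A(1) f0 by (intro mult_mono) auto
      then show ?thesis using f0 by (simp add: z1_def)
    qed
  next
    case False
    then have z1\<tau>: "z1 \<noteq> \<tau>" and 0: "0 \<notin> T" by auto
    have d: "d > 0" using z1\<tau> by (simp add: d_def)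
    have z1: "norm z1 < 1" using TD z1T z1\<tau> by blast
    have \<tau>0: "\<tau> \<noteq> 0" using \<tau> by auto
    have c\<tau>: "cnj \<tau> = 1 / \<tau>"
      using \<tau> \<tau>0 by (metis complex_div_cnj div_by_1 of_real_1 one_power2 mult_1 complex_cnj_one)
    define S where "S = cball 0 1 - T"
    define E where "E = ball 0 1 - T"
    define \<rho> where "\<rho> z = (z - z1) / (z - \<tau>)" for z
    have compT: "compact T" using \<gamma>(1) by (simp add: T_def compact_path_image)
    have openE: "open E" unfolding E_def using compT by (simp add: compact_imp_closed open_Diff)
    have ES: "E \<subseteq> S" by (auto simp: E_def S_def)
    have nz: "z \<noteq> \<tau>" "z \<noteq> z1" if "z \<in> S" for z
      using that \<tau>T z1T by (auto simp: S_def)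
    have \<rho>1: "\<rho> z - 1 = (\<tau> - z1) / (z - \<tau>)" if "z \<noteq> \<tau>" for z
      using that by (simp add: \<rho>_def field_simps)
    have \<rho>ne1: "\<rho> z \<noteq> 1" if "z \<in> S" for z
      using \<rho>1[OF nz(1)[OF that]] z1\<tau> nz(1)[OF that] by auto
    have m\<tau>S: "-\<tau> \<in> S"
      using TD[of "-\<tau>"] \<tau> \<tau>0 by (auto simp: S_def)
    obtain R0 where R0: "continuous_on S R0" "\<And>z. z \<in> S \<Longrightarrow> (R0 z)\<^sup>2 = \<rho> z"
      using continuous_sqrt_quotient_off_path[OF \<gamma>(1), of S] \<gamma>(2)
      unfolding \<rho>_def z1_def S_def T_def by (metis Diff_disjoint inf_commute)
    \<comment> \<open>Of the two square roots, the one with positive real part at \<open>-\<tau>\<close>.\<close>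
    define R where "R z = (if Re (R0 (-\<tau>)) < 0 then - R0 z else R0 z)" for z
    have contR: "continuous_on S R"
      using R0(1) by (cases "Re (R0 (-\<tau>)) < 0") (simp_all add: R_def continuous_on_minus)
    have R2: "(R z)\<^sup>2 = \<rho> z" if "z \<in> S" for z
      using R0(2)[OF that] by (simp add: R_def)
    have Rre: "Re (R z) \<noteq> 0" if "z \<in> S" "Re (\<rho> z) > 0" for z
    proof -
      have "Re ((R z)\<^sup>2) > 0" using that R2 by simp
      then show ?thesis by (auto simp: Re_power2)
    qed
    have "Re (\<rho> (-\<tau>)) > 0"
    proof -
      define y where "y = z1 * cnj \<tau>"
      have \<rho>y: "\<rho> (-\<tau>) = (1 + y) / 2"
        using \<tau>0 by (simp add: \<rho>_def y_def c\<tau> field_simps)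
      have "\<bar>Re y\<bar> < 1"
        using abs_Re_le_cmod[of y] z1 \<tau> by (simp add: y_def norm_mult)
      then show ?thesis
        unfolding \<rho>y by (simp add: abs_less_iff)
    qed
    from Rre[OF m\<tau>S this] have Rm\<tau>: "Re (R (-\<tau>)) > 0"
      by (auto simp: R_def split: if_splits)

    \<comment> \<open>Away from \<open>\<tau>\<close> the quotient \<open>\<rho>\<close> is close to \<open>1\<close>, so \<open>Re (R z)\<close> never vanishes there, and by
      connectedness it keeps the sign that it has at \<open>-\<tau>\<close>.\<close>
    have Rpos: "Re (R z) > 0" if z: "z \<in> cball 0 1" "dist \<tau> z \<ge> 2 * d" for z
    proof -
      let ?V = "cball 0 1 - ball \<tau> (2 * d)"
      have VS: "?V \<subseteq> S"
      proof
        fix w assume w: "w \<in> ?V"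
        have "w \<notin> T"
        proof
          assume "w \<in> T"
          then have "dist \<tau> w \<le> d" using far by (auto simp: T_def d_def z1_def)
          then show False using w d by simp
        qed
        then show "w \<in> S" using w by (simp add: S_def)
      qed
      have "- \<tau> \<in> ?V"
      proof -
        have "dist \<tau> z \<le> 2" using z(1) \<tau> norm_triangle_ineq4[of \<tau> z] by (simp add: dist_norm)
        then show ?thesis using z(2) \<tau> by (simp add: dist_norm flip: mult_2)
      qed
      have ne: "Re (R w) \<noteq> 0" if "w \<in> ?V" for w
      proof (rule Rre)
        show "w \<in> S" using that VS by blast
        have "w \<noteq> \<tau>" using that d by auto
        have "norm (\<rho> w - 1) = d / norm (w - \<tau>)"
          using \<rho>1[OF \<open>w \<noteq> \<tau>\<close>] by (simp add: norm_divide d_def norm_minus_commute)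
        also have "\<dots> \<le> 1 / 2"
          using that d by (simp add: dist_norm norm_minus_commute divide_le_eq)
        finally have "\<bar>Re (\<rho> w - 1)\<bar> \<le> 1/2" using abs_Re_le_cmod order_trans by blast
        then show "Re (\<rho> w) > 0" unfolding abs_le_iff minus_complex.simps by simp
      qed
      have "connected ((\<lambda>w. Re (R w)) ` ?V)"
        using VS contR
        by (intro connected_continuous_image connected_cball_minus_ball \<tau> continuous_intros)
          (auto intro: continuous_on_subset)
      from connectedD_interval[OF this, of "Re (R z)" "Re (R (-\<tau>))" 0] 
      show ?thesis
        using ne z \<open>- \<tau> \<in> ?V\<close> Rm\<tau> by force
    qed

    define Y where "Y z = (R z - 1) / (R z + 1)" for z
    have Rp1: "R z + 1 \<noteq> 0" if "z \<in> S" for z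
    proof
      assume "R z + 1 = 0"
      then have "R z = -1" by (simp add: eq_neg_iff_add_eq_0)
      then show False using R2[OF that] \<rho>ne1[OF that] by simp
    qed
    have Y16: "norm (Y z) \<le> 16" if "z \<in> S" for z
    proof (cases "dist \<tau> z \<ge> 2 * d")
      case True
      then show ?thesis
        using cayley_norm_le_1[of "R z"] Rpos[of z] that by (simp add: Y_def S_def)
    next
      case False
      have "norm ((R z)\<^sup>2 - 1) = d / dist \<tau> z"
        using \<rho>1[OF nz(1)[OF that]] R2[OF that] by (simp add: norm_divide d_def dist_norm norm_minus_commute)
      also have "\<dots> > 1/2"
        using False nz(1)[OF that] d by (simp add: field_simps)
      finally show ?thesis unfolding Y_def by (rule cayley_norm_le_16)
    qed
    have holR: "R holomorphic_on E"
    proof (rule holomorphic_on_continuous_sqrt[OF openE])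
      show "continuous_on E R" using contR ES continuous_on_subset by blast
      have "\<rho> holomorphic_on E"
        unfolding \<rho>_def using nz(1) ES by (intro holomorphic_intros) auto
      then show "(\<lambda>z. (R z)\<^sup>2) holomorphic_on E"
        by (rule holomorphic_transform) (use R2 ES in auto)
      show "R z \<noteq> 0" if "z \<in> E" for z
        using R2[of z] that ES nz[of z] by (auto simp: \<rho>_def)
    qed
    have holY: "Y holomorphic_on E"
      unfolding Y_def using Rp1 ES by (intro holomorphic_intros holR) auto
    have contY: "continuous_on S Y"
      unfolding Y_def using Rp1 by (intro continuous_intros contR) auto
    have Y0: "d / 4 \<le> norm (Y 0)"
    proof -
      have S0: "0 \<in> S" using 0 by (simp add: S_def)
      have "norm ((R 0)\<^sup>2) \<le> 1"
        using R2[OF S0] z1 \<tau> by (simp add: \<rho>_def norm_divide)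
      then have "norm (R 0) \<le> 1"
        by (simp add: norm_power abs_square_le_1)
      then have R01: "norm (R 0 + 1) \<le> 2"
        using norm_triangle_ineq[of "R 0" 1] by simp
      have "norm (R 0 + 1) > 0" using Rp1[OF S0] by simp
      have "d = norm (\<rho> 0 - 1)"
        using \<rho>1[of 0] \<tau> \<tau>0 by (simp add: norm_divide d_def norm_minus_commute)
      also have "\<rho> 0 - 1 = Y 0 * (R 0 + 1)\<^sup>2"
        using R2[OF S0, symmetric] Rp1[OF S0] by (simp add: Y_def field_simps power2_eq_square)
      also have "norm \<dots> = norm (Y 0) * (norm (R 0 + 1))\<^sup>2"
        by (simp add: norm_mult norm_power)
      also have "\<dots> \<le> norm (Y 0) * 2\<^sup>2"
        using R01 by (intro mult_left_mono power_mono) auto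
      finally show ?thesis by simp
    qed

    \<comment> \<open>\<open>\<sigma>\<close> is the reflection of \<open>\<rho>\<close> in the unit circle.\<close>
    define \<sigma> where "\<sigma> z = (1 - cnj z1 * z) / (1 - cnj \<tau> * z)" for z
    define Q where "Q z = csqrt (\<sigma> z)" for z
    define Z where "Z z = (Q z - 1) / (Q z + 1)" for z
    have den: "Re (1 - cnj \<tau> * z) > 0" if "norm z \<le> 1" "z \<noteq> \<tau>" for z
    proof -
      have n: "norm (cnj \<tau> * z) \<le> 1" using that \<tau> by (simp add: norm_mult)
      have "Re (cnj \<tau> * z) \<noteq> 1"
      proof
        assume 1: "Re (cnj \<tau> * z) = 1"
        have "(Im (cnj \<tau> * z))\<^sup>2 \<le> 0"
          using n 1 cmod_power2[of "cnj \<tau> * z"] abs_square_le_1[of "norm (cnj \<tau> * z)"] by simp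
        then have "cnj \<tau> * z = 1" using 1 by (simp add: complex_eq_iff)
        then show False using that \<tau>0 by (simp add: c\<tau> field_simps)
      qed
      moreover have "Re (cnj \<tau> * z) \<le> 1" using n complex_Re_le_cmod order_trans by blast
      ultimately show ?thesis by simp
    qed
    have num: "Re (1 - cnj z1 * z) > 0" if "norm z \<le> 1" for z
    proof -
      have "norm (cnj z1 * z) \<le> norm z1 * 1" 
        unfolding norm_mult using that by (intro mult_mono) auto
      then have "Re (cnj z1 * z) < 1" using z1 complex_Re_le_cmod[of "cnj z1 * z"] by linarith
      then show ?thesis by simp
    qed
    have \<sigma>np: "\<sigma> z \<notin> \<real>\<^sub>\<le>\<^sub>0" if "norm z \<le> 1" "z \<noteq> \<tau>" for z
    proof
      assume "\<sigma> z \<in> \<real>\<^sub>\<le>\<^sub>0"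
      then obtain x where x: "x \<le> 0" "\<sigma> z = of_real x" by (auto simp: nonpos_Reals_def)
      have "1 - cnj \<tau> * z \<noteq> 0" using den[OF that] by (metis less_irrefl zero_complex.simps(1))
      then have "1 - cnj z1 * z = of_real x * (1 - cnj \<tau> * z)"
        using x(2) by (simp add: \<sigma>_def field_simps)
      then have "Re (1 - cnj z1 * z) = x * Re (1 - cnj \<tau> * z)"
        by (metis Re_complex_of_real scaleR_conv_of_real scaleR_complex.simps(1))
      then show False using num[OF that(1)] den[OF that] x(1)
        by (metis mult_nonpos_nonneg not_less order_less_imp_le)
    qed
    have Qpos: "Re (Q z) > 0" if "norm z \<le> 1" "z \<noteq> \<tau>" for z
    proof -
      have "Re (Q z) \<noteq> 0"
      proof
        assume "Re (Q z) = 0"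
        moreover have "\<sigma> z = (Q z)\<^sup>2" by (simp add: Q_def)
        ultimately have "Re (\<sigma> z) \<le> 0 \<and> Im (\<sigma> z) = 0"
          unfolding \<open>\<sigma> z = (Q z)\<^sup>2\<close> Re_power2 Im_power2 by simp
        then show False using \<sigma>np[OF that] by (simp add: complex_nonpos_Reals_iff)
      qed
      moreover have "Re (Q z) \<ge> 0" unfolding Q_def using csqrt_principal[of "\<sigma> z"] by linarith
      ultimately show ?thesis by simp
    qed
    have Qp1: "Q z + 1 \<noteq> 0" if "norm z \<le> 1" "z \<noteq> \<tau>" for z
      using Qpos[OF that] by (auto simp: complex_eq_iff)
    have Z1: "norm (Z z) \<le> 1" if "norm z \<le> 1" "z \<noteq> \<tau>" for z
      unfolding Z_def using Qpos[OF that] by (intro cayley_norm_le_1) simp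
    have dnz: "1 - cnj \<tau> * z \<noteq> 0" if "norm z \<le> 1" "z \<noteq> \<tau>" for z
      using den[OF that] by (metis less_irrefl zero_complex.simps(1))
    have holZ: "Z holomorphic_on E"
    proof -
      have "z \<in> E \<Longrightarrow> norm z \<le> 1 \<and> z \<noteq> \<tau>" for z using nz(1)[of z] by (auto simp: E_def S_def)
      then show ?thesis
        unfolding Z_def Q_def using Qp1 \<sigma>np dnz unfolding \<sigma>_def Q_def
        by (intro holomorphic_intros) auto
    qed
    have contQ: "continuous_on S Q"
    proof -
      have "z \<in> S \<Longrightarrow> norm z \<le> 1 \<and> z \<noteq> \<tau>" for z using nz(1)[of z] by (auto simp: S_def)
      then show ?thesis
        unfolding Q_def using \<sigma>np dnz unfolding \<sigma>_def
        by (intro continuous_on_compose2[OF continuous_on_csqrt] continuous_intros) auto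
    qed
    have contZ: "continuous_on S Z"
      unfolding Z_def using Qp1 nz(1) by (intro continuous_intros contQ) (auto simp: S_def)
    have Z0: "Z 0 = 0" by (simp add: Z_def Q_def \<sigma>_def)

    \<comment> \<open>Both sides square to \<open>\<rho>\<close>, so they agree up to a sign, which is constant on the connected set
      obtained from the circle by removing \<open>\<tau>\<close>, and which is \<open>+\<close> at \<open>-\<tau>\<close>.\<close>
    have circ: "R z = cnj (Q z)" if "norm z = 1" "z \<noteq> \<tau>" for z
    proof -
      let ?C = "sphere 0 1 - {\<tau>}"
      have CS: "?C \<subseteq> S" using TD by (force simp: S_def)
      have sq: "(R w)\<^sup>2 = (cnj (Q w))\<^sup>2" if "w \<in> ?C" for w
      proof -
        have w0: "w \<noteq> 0" using that by auto
        have cw: "cnj w = 1 / w"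
          using that w0 by (metis DiffD1 complex_div_cnj div_by_1 dist_0_norm mem_sphere mult_1 of_real_1 one_power2 complex_cnj_one)
        have "(cnj (Q w))\<^sup>2 = cnj (\<sigma> w)" by (simp add: Q_def flip: complex_cnj_power)
        also have "\<dots> = \<rho> w"
          using w0 that by (simp add: \<sigma>_def \<rho>_def cw divide_simps)
        finally show ?thesis using R2[of w] that CS by auto
      qed
      let ?q = "\<lambda>w. R w / cnj (Q w)"
      have Qnz: "Q w \<noteq> 0" if "w \<in> ?C" for w
        using Qpos[of w] that by auto
      have qv: "?q w = 1 \<or> ?q w = -1" if "w \<in> ?C" for w
        using sq[OF that] Qnz[OF that] by (auto simp: power2_eq_iff)
      have "?q constant_on ?C"
      proof (rule continuous_finite_range_constant)
        show "connected ?C" by (rule connected_circle_minus_point[OF \<tau>])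
        show "continuous_on ?C ?q"
          using contR contQ CS Qnz by (intro continuous_intros) (auto intro: continuous_on_subset)
        show "finite (?q ` ?C)"
          by (rule finite_subset[of _ "{1, -1}"]) (use qv in blast)+
      qed
      moreover have "-\<tau> \<in> ?C" "z \<in> ?C" using \<tau> \<tau>0 that by auto
      ultimately have "?q z = ?q (-\<tau>)" by (auto simp: constant_on_def)
      moreover have "?q (-\<tau>) = 1"
      proof -
        have "?q (-\<tau>) \<noteq> -1"
        proof
          assume "?q (-\<tau>) = -1"
          then have "R (-\<tau>) = - cnj (Q (-\<tau>))" using Qnz[OF \<open>-\<tau> \<in> ?C\<close>] by (simp add: divide_eq_eq)
          then have "Re (R (-\<tau>)) = - Re (Q (-\<tau>))" by simp
          then show False using Rm\<tau> Qpos[of "-\<tau>"] \<tau> \<tau>0 by auto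
        qed
        then show ?thesis using qv[OF \<open>-\<tau> \<in> ?C\<close>] by blast
      qed
      ultimately show ?thesis using Qnz[OF \<open>z \<in> ?C\<close>] by simp
    qed
    have circY: "Y z = cnj (Z z)" if "norm z = 1" "z \<noteq> \<tau>" for z
      using circ[OF that] by (simp add: Y_def Z_def)

    have "Y 0 \<noteq> 0" using Y0 d by auto
    define a where "a = cnj (Y 0) / norm (Y 0)"
    have na: "norm a = 1" using \<open>Y 0 \<noteq> 0\<close> by (simp add: a_def norm_divide)
    have aY: "a * Y 0 = norm (Y 0)"
      using \<open>Y 0 \<noteq> 0\<close> by (simp add: a_def field_simps complex_norm_square[symmetric] power2_eq_square)
    \<comment> \<open>The logarithm tends to \<open>-\<infinity>\<close> at \<open>\<tau>\<close> and so takes care of that single boundary point, where the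
      other terms have no limit; at \<open>0\<close> it costs only \<open>\<epsilon> * ln 2\<close>.\<close>
    have key: "norm (Y 0) \<le> 17 / A * Re (f 0) + \<epsilon> * ln 2" if "\<epsilon> > 0" for \<epsilon>
    proof -
      define U where "U z = a * Y z - cnj a * Z z" for z
      define G where "G z = U z - of_real (17 / A) * f z + of_real \<epsilon> * Ln ((1 - cnj \<tau> * z) / 2)" for z
      have U17: "Re (U z) \<le> 17" if "z \<in> S" for z
      proof -
        have "Re (U z) \<le> norm (a * Y z) + norm (cnj a * Z z)"
          unfolding U_def using complex_Re_le_cmod norm_triangle_ineq4 order_trans by blast
        also have "\<dots> \<le> 16 + 1"
          using Y16[OF that] Z1[of z] nz(1)[OF that] that na by (intro add_mono) (auto simp: norm_mult S_def)
        finally show ?thesis by simp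
      qed
      have ReG: "Re (G z) = Re (U z) - 17 / A * Re (f z) + \<epsilon> * ln (dist z \<tau> / 2)" if "z \<in> E" for z
      proof -
        have z: "norm z \<le> 1" "z \<noteq> \<tau>" using that nz(1)[of z] ES by (auto simp: E_def)
        have "1 - cnj \<tau> * z = cnj \<tau> * (\<tau> - z)" using \<tau>0 by (simp add: c\<tau> field_simps)
        then have "norm (1 - cnj \<tau> * z) = dist z \<tau>"
          using \<tau> by (simp add: norm_mult dist_norm norm_minus_commute)
        then show ?thesis
          using dnz[OF z] by (simp add: G_def norm_divide)
      qed
      have ln0: "ln (dist z \<tau> / 2) \<le> 0" if "z \<in> E" for z
      proof -
        have "dist z \<tau> \<le> 2" using that \<tau> norm_triangle_ineq4[of z \<tau>] by (simp add: E_def dist_norm)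
        moreover have "dist z \<tau> > 0" using that nz(1)[of z] ES by auto
        ultimately show ?thesis by simp
      qed
      have fpos: "17 / A * Re (f z) \<ge> 0" if "z \<in> E" for z
        using pos[of z] A(1) that by (simp add: E_def less_imp_le)
      have "norm (exp (G 0)) \<le> 1"
      proof (rule maximum_modulus_limsup[where F = "\<lambda>z. exp (G z)" and E = E])
        have "(1 - cnj \<tau> * z) / 2 \<notin> \<real>\<^sub>\<le>\<^sub>0" if "z \<in> E" for z
          using den[of z] that nz(1)[of z] ES by (auto simp: complex_nonpos_Reals_iff E_def simp del: times_complex.simps)
        then show "(\<lambda>z. exp (G z)) holomorphic_on E"
          unfolding G_def U_def
          by (intro holomorphic_intros holY holZ holomorphic_on_subset[OF holf]) (auto simp: E_def)
        show "open E" by (rule openE)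
        show "bounded E" by (rule bounded_subset[OF bounded_ball[of 0 1]]) (auto simp: E_def)
        show "0 \<in> E" using 0 by (simp add: E_def)
        fix \<xi> and e :: real assume \<xi>: "\<xi> \<in> frontier E" and e: "e > 0"
        have EE: "\<forall>\<^sub>F z in at \<xi> within E. z \<in> E" by (simp add: eventually_at_filter)
        have \<xi>S: "\<xi> \<in> T \<or> \<xi> \<in> S \<and> norm \<xi> = 1"
        proof -
          have "closure E \<subseteq> cball 0 1"
            by (rule closure_minimal) (auto simp: E_def)
          then have "norm \<xi> \<le> 1" using \<xi> by (auto simp: frontier_def)
          moreover have "\<xi> \<notin> E" using \<xi> openE by (simp add: frontier_def interior_open)
          ultimately show ?thesis by (auto simp: E_def S_def)
        qed
        consider "\<xi> = \<tau>" | "\<xi> \<in> T" "\<xi> \<noteq> \<tau>" | "\<xi> \<in> S" "norm \<xi> = 1" "\<xi> \<noteq> \<tau>"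
          using \<xi>S \<tau>T by blast
        then show "\<forall>\<^sub>F z in at \<xi> within E. norm (exp (G z)) \<le> 1 + e"
        proof cases
          \<comment> \<open>At \<open>\<tau>\<close> the logarithm wins against the bound \<open>17\<close>.\<close>
          case 1
          have "\<forall>\<^sub>F z in at \<xi> within E. dist z \<tau> < 2 * exp (- 17 / \<epsilon>)"
            unfolding 1 eventually_at by (intro exI[of _ "2 * exp (- 17 / \<epsilon>)"]) auto
          with EE show ?thesis
          proof eventually_elim
            case (elim z)
            have "dist z \<tau> > 0" using elim nz(1)[of z] ES by auto
            then have "ln (dist z \<tau> / 2) \<le> ln (exp (- 17 / \<epsilon>))"
              using elim by (subst ln_le_cancel_iff) auto
            then have "\<epsilon> * ln (dist z \<tau> / 2) \<le> \<epsilon> * (- 17 / \<epsilon>)"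
              using \<open>\<epsilon> > 0\<close> by (intro mult_left_mono) auto
            then have "Re (G z) \<le> 0"
              using ReG[of z] U17[of z] fpos[of z] elim ES \<open>\<epsilon> > 0\<close> by auto
            then have "exp (Re (G z)) \<le> 1" by simp
            then have "exp (Re (G z)) \<le> 1 + e" using e by linarith
            then show ?case by simp
          qed
        next
          \<comment> \<open>At the other points of the path \<open>Re (f z) \<ge> A\<close>, so the term with \<open>f\<close> is at least \<open>17\<close>.\<close>
          case 2
          have "isCont f \<xi>"
            using holf TD[OF 2] by (intro holomorphic_on_imp_continuous_on[THEN continuous_on_interior]) (auto simp: interior_open)
          then have "(f \<longlongrightarrow> f \<xi>) (at \<xi> within E)"
            using continuous_at_imp_continuous_at_within continuous_within by blast
          then have "((\<lambda>z. exp (17 - 17 / A * Re (f z))) \<longlongrightarrow> exp (17 - 17 / A * Re (f \<xi>))) (at \<xi> within E)"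
            by (intro tendsto_intros)
          moreover have "exp (17 - 17 / A * Re (f \<xi>)) < 1 + e"
          proof -
            have "17 / A * A \<le> 17 / A * Re (f \<xi>)"
              using A 2 by (intro mult_left_mono) (auto simp: T_def)
            then have "exp (17 - 17 / A * Re (f \<xi>)) \<le> 1" using A(1) by simp
            then show ?thesis using e by linarith
          qed
          ultimately have "\<forall>\<^sub>F z in at \<xi> within E. exp (17 - 17 / A * Re (f z)) < 1 + e"
            by (rule order_tendstoD)
          with EE show ?thesis
          proof eventually_elim
            case (elim z)
            have "\<epsilon> * ln (dist z \<tau> / 2) \<le> 0"
              using ln0[of z] elim \<open>\<epsilon> > 0\<close> by (simp add: mult_le_0_iff)
            then have "Re (G z) \<le> 17 - 17 / A * Re (f z)"
              using ReG[of z] U17[of z] elim ES by auto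
            then have "exp (Re (G z)) \<le> exp (17 - 17 / A * Re (f z))" by simp
            with elim have "exp (Re (G z)) \<le> 1 + e" by linarith
            then show ?case by simp
          qed
        next
          \<comment> \<open>On the circle, \<open>U\<close> is purely imaginary by reflection.\<close>
          case 3
          have "continuous_on S U" unfolding U_def by (intro continuous_intros contY contZ)
          then have "(U \<longlongrightarrow> U \<xi>) (at \<xi> within E)"
            using 3 ES by (meson continuous_on_def tendsto_within_subset)
          then have "((\<lambda>z. exp (Re (U z))) \<longlongrightarrow> exp (Re (U \<xi>))) (at \<xi> within E)"
            by (intro tendsto_intros)
          moreover have "exp (Re (U \<xi>)) < 1 + e"
          proof -
            have "U \<xi> = cnj (cnj a * Z \<xi>) - cnj a * Z \<xi>" using circY[OF 3(2,3)] by (simp add: U_def)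
            then have "Re (U \<xi>) = 0" by (simp del: times_complex.simps complex_cnj_mult)
            then show ?thesis using e by simp
          qed
          ultimately have "\<forall>\<^sub>F z in at \<xi> within E. exp (Re (U z)) < 1 + e"
            by (rule order_tendstoD)
          with EE show ?thesis
          proof eventually_elim
            case (elim z)
            have "\<epsilon> * ln (dist z \<tau> / 2) \<le> 0"
              using ln0[of z] elim \<open>\<epsilon> > 0\<close> by (simp add: mult_le_0_iff)
            then have "Re (G z) \<le> Re (U z)"
              using ReG[of z] fpos[of z] elim by auto
            then have "exp (Re (G z)) \<le> exp (Re (U z))" by simp
            with elim have "exp (Re (G z)) \<le> 1 + e" by linarith
            then show ?case by simp
          qed
        qed
      qed
      then have "Re (G 0) \<le> 0" by simp
      moreover have "Re (G 0) = norm (Y 0) - 17 / A * Re (f 0) + \<epsilon> * ln (1 / 2)"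
      proof -
        have "Re (U 0) = norm (Y 0)" unfolding U_def using aY by (simp add: Z0)
        then show ?thesis using ReG[of 0] 0 \<tau> by (simp add: E_def)
      qed
      ultimately show ?thesis by (simp add: ln_div)
    qed
    have "norm (Y 0) \<le> 17 / A * Re (f 0)"
    proof (rule field_le_epsilon)
      fix e :: real assume "e > 0"
      then show "norm (Y 0) \<le> 17 / A * Re (f 0) + e"
        using key[of "e / ln 2"] by simp
    qed
    then have "d / 4 \<le> 17 / A * Re (f 0)" using Y0 by linarith
    then show ?thesis using A(1) by (simp add: d_def z1_def field_simps)
  qed
qed

text \<open>
  The general case: keep only the part of the path after its point farthest from \<open>\<tau>\<close>.
\<close>

corollary path_barrier:
  fixes f :: "complex \<Rightarrow> complex"
  assumes holf: "f holomorphic_on ball 0 1"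
    and pos: "\<And>z. z \<in> ball 0 1 \<Longrightarrow> Re (f z) > 0"
    and \<tau>: "norm \<tau> = 1"
    and \<gamma>: "path \<gamma>" "pathfinish \<gamma> = \<tau>" "path_image \<gamma> \<subseteq> insert \<tau> (ball 0 1)"
    and A: "A > 0" "\<And>z. z \<in> path_image \<gamma> - {\<tau>} \<Longrightarrow> A \<le> Re (f z)"
    and "z0 \<in> path_image \<gamma>"
  shows "A * norm (z0 - \<tau>) \<le> 68 * Re (f 0)"
proof -
  have "compact (path_image \<gamma>)" "path_image \<gamma> \<noteq> {}"
    using \<gamma>(1) by (simp_all add: compact_path_image)
  moreover have "continuous_on (path_image \<gamma>) (\<lambda>z. norm (z - \<tau>))"
    by (intro continuous_intros)
  ultimately obtain w where w: "w \<in> path_image \<gamma>"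
      "\<And>z. z \<in> path_image \<gamma> \<Longrightarrow> norm (z - \<tau>) \<le> norm (w - \<tau>)"
    using continuous_attains_sup by metis
  obtain u where u: "u \<in> {0..1}" "w = \<gamma> u"
    using w(1) by (auto simp: path_image_def)
  let ?\<gamma> = "subpath u 1 \<gamma>"
  have sub: "path_image ?\<gamma> \<subseteq> path_image \<gamma>"
    using u by (intro path_image_subpath_subset) auto
  have "A * norm (pathstart ?\<gamma> - \<tau>) \<le> 68 * Re (f 0)"
  proof (rule path_barrier_from_farthest_point[OF holf pos \<tau>])
    show "path ?\<gamma>" using \<gamma>(1) u by (intro path_subpath) auto
    show "pathfinish ?\<gamma> = \<tau>" using \<gamma>(2) by (simp add: pathfinish_def subpath_def)
    show "path_image ?\<gamma> \<subseteq> insert \<tau> (ball 0 1)" using sub \<gamma>(3) by blast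
    show "path_image ?\<gamma> \<subseteq> cball \<tau> (norm (pathstart ?\<gamma> - \<tau>))"
      using sub w(2) u by (auto simp: dist_norm norm_minus_commute)
  qed (use A sub in auto)
  then have "A * norm (w - \<tau>) \<le> 68 * Re (f 0)"
    using u by simp
  moreover have "A * norm (z0 - \<tau>) \<le> A * norm (w - \<tau>)"
    using w(2)[OF \<open>z0 \<in> path_image \<gamma>\<close>] A(1) by simp
  ultimately show ?thesis by linarith
qed

section \<open>Schwarz-Pick inequality and hyperbolic projection\<close>

lemma Schwarz_Pick_deriv:
  assumes g: "g holomorphic_on ball w r" and r: "r > 0"
    and ran: "\<And>z. z \<in> ball w r \<Longrightarrow> norm (g z) < 1"
  shows "r * norm (deriv g w) \<le> 1 - (norm (g w))\<^sup>2"
proof -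
  define a where "a = g w"
  have a: "norm a < 1" using ran[of w] r by (simp add: a_def)
  define k where "k z = Moebius_function 0 a (g (w + of_real r * z))" for z
  have inb: "w + of_real r * z \<in> ball w r" if "z \<in> ball 0 1" for z
    using that r by (simp add: dist_norm norm_mult)
  have hk: "k holomorphic_on ball 0 1"
    unfolding k_def
    by (rule holomorphic_on_compose_gen[OF _ Moebius_function_holomorphic[OF a], unfolded o_def])
      (use inb ran in \<open>auto intro!: holomorphic_intros holomorphic_on_compose_gen[OF _ g, unfolded o_def]\<close>)
  have "norm (deriv k 0) \<le> 1"
  proof (rule Schwarz_Lemma(2)[OF hk, of 0])
    show "k 0 = 0" by (simp add: k_def a_def Moebius_function_eq_zero)
    show "norm (k z) < 1" if "norm z < 1" for z
      unfolding k_def using inb[of z] ran that a by (intro Moebius_function_norm_lt_1) auto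
  qed auto
  have "(g has_field_derivative deriv g w) (at w)"
    using g r by (intro holomorphic_derivI[OF g]) auto
  then have dg: "((\<lambda>z. g (w + of_real r * z)) has_field_derivative (deriv g w * of_real r)) (at 0)"
    by (intro DERIV_chain2[where f = g]) (auto intro!: derivative_eq_intros)
  have nz: "1 - cnj a * a \<noteq> 0"
    using a complex_norm_square[of a, symmetric] by (simp add: mult.commute abs_square_eq_1 flip: of_real_power)
  have "(k has_field_derivative (deriv g w * of_real r / (1 - cnj a * a))) (at 0)"
    unfolding k_def Moebius_function_simple
    by (rule derivative_eq_intros dg refl | use nz in \<open>simp add: a_def\<close>)+
  then have "deriv k 0 = deriv g w * of_real r / (1 - cnj a * a)"
    by (rule DERIV_imp_deriv)
  moreover have "1 - cnj a * a = of_real (1 - (norm a)\<^sup>2)"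
    using complex_norm_square[of a] by (simp add: mult.commute)
  moreover have "1 - (norm a)\<^sup>2 > 0"
    using a by (simp add: abs_square_less_1)
  ultimately have "norm (deriv k 0) = norm (deriv g w) * r / (1 - (norm a)\<^sup>2)"
    using r by (simp add: norm_mult norm_divide del: of_real_diff)
  with \<open>norm (deriv k 0) \<le> 1\<close> \<open>1 - (norm a)\<^sup>2 > 0\<close> show ?thesis
    by (simp add: a_def mult.commute divide_le_eq)
qed

lemma hyperbolic_dist_less_iff:
  assumes "norm z < 1" "norm u < 1" "norm v < 1"
  shows "hyperbolic_dist z u < hyperbolic_dist z v \<longleftrightarrow>
    (norm (Moebius_function 0 z u))\<^sup>2 < (norm (Moebius_function 0 z v))\<^sup>2"
proof -
  define a b where "a = norm (Moebius_function 0 z u)" and "b = norm (Moebius_function 0 z v)"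
  have ab: "0 \<le> a" "a < 1" "0 \<le> b" "b < 1"
    using assms Moebius_function_norm_lt_1 by (simp_all add: a_def b_def)
  have "hyperbolic_dist z u < hyperbolic_dist z v \<longleftrightarrow> (1 + a) / (1 - a) < (1 + b) / (1 - b)"
    using ab by (simp add: hyperbolic_dist_def ln_less_cancel_iff flip: a_def b_def)
  also have "\<dots> \<longleftrightarrow> a < b"
    using ab by (simp add: divide_simps) (simp add: algebra_simps)
  also have "\<dots> \<longleftrightarrow> a\<^sup>2 < b\<^sup>2"
    using ab using power_strict_mono[of a b 2] power_mono[of b a 2] by (meson not_less zero_less_numeral)
  finally show ?thesis by (simp add: a_def b_def)
qed

text \<open>
  The point \<open>r\<close> of the diameter enters only through \<open>k = (1 + r) / (1 - r)\<close>, its coordinate after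
  the disc is mapped to the right half-plane with \<open>\<tau>\<close> sent to infinity; the expression to be
  minimised is then \<open>a\<^sup>2 / k + b\<^sup>2 * k\<close>.
\<close>

lemma norm_Moebius_diameter:
  assumes \<tau>: "norm \<tau> = 1" and z: "norm z < 1" and r: "-1 < r" "r < 1"
  defines "a \<equiv> norm (\<tau> + z)" and "b \<equiv> norm (\<tau> - z)"
  shows "(norm (Moebius_function 0 z (of_real r * \<tau>)))\<^sup>2 =
     1 - 4 * (1 - (norm z)\<^sup>2) /
         ((1 - r) / (1 + r) * a\<^sup>2 + (1 + r) / (1 - r) * b\<^sup>2 + 2 * (1 - (norm z)\<^sup>2))"
proof -
  define x where "x = z \<bullet> \<tau>"
  define m where "m = (norm z)\<^sup>2"
  have n1: "(norm (of_real r * \<tau> - z))\<^sup>2 = r\<^sup>2 - 2 * r * x + m"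
    unfolding x_def m_def power2_norm_eq_inner scaleR_conv_of_real[symmetric]
    using \<tau> by (simp add: inner_diff_left inner_diff_right inner_commute power2_eq_square norm_eq_1)
  have "(Re \<tau>)\<^sup>2 + (Im \<tau>)\<^sup>2 = 1"
    using \<tau> by (simp flip: cmod_power2)
  then have n2: "(norm (1 - cnj z * (of_real r * \<tau>)))\<^sup>2 = 1 - 2 * r * x + r\<^sup>2 * m"
    unfolding x_def m_def cmod_power2 inner_complex_def by simp algebra
  have a2: "a\<^sup>2 = 1 + 2 * x + m" and b2: "b\<^sup>2 = 1 - 2 * x + m"
    unfolding a_def b_def x_def m_def power2_norm_eq_inner
    using \<tau> by (simp_all add: inner_add_left inner_add_right inner_diff_left inner_diff_right inner_commute norm_eq_1)
  define N where "N = 1 - 2 * r * x + r\<^sup>2 * m"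
  have Npos: "N > 0"
  proof -
    have "norm (cnj z * (of_real r * \<tau>)) = norm z * \<bar>r\<bar>" by (simp add: norm_mult \<tau>)
    also have "\<dots> < 1" using z r mult_strict_mono'[of "norm z" 1 "\<bar>r\<bar>" 1] by simp
    finally have "1 - cnj z * (of_real r * \<tau>) \<noteq> 0" by auto
    then show ?thesis unfolding N_def n2[symmetric] by simp
  qed
  have den: "(1 - r) / (1 + r) * a\<^sup>2 + (1 + r) / (1 - r) * b\<^sup>2 + 2 * (1 - m) = 4 * N / (1 - r\<^sup>2)"
  proof -
    have "1 - r\<^sup>2 = (1 - r) * (1 + r)" by (simp add: power2_eq_square algebra_simps)
    then show ?thesis using r unfolding a2 b2 N_def
      by (simp add: divide_simps) (simp add: power2_eq_square algebra_simps)
  qed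
  have "1 - r\<^sup>2 > 0" using r by (simp add: abs_square_less_1)
  have "(norm (Moebius_function 0 z (of_real r * \<tau>)))\<^sup>2 = (r\<^sup>2 - 2 * r * x + m) / N"
    by (simp add: Moebius_function_simple norm_divide power_divide n1 n2 N_def)
  also have "\<dots> = 1 - 4 * (1 - m) / (4 * N / (1 - r\<^sup>2))"
    using Npos \<open>1 - r\<^sup>2 > 0\<close> by (simp add: field_simps) (simp add: N_def algebra_simps)
  finally show ?thesis unfolding den[symmetric] m_def .
qed

text \<open>
  In the half-plane coordinate \<open>k = (1 + r) / (1 - r)\<close>, the inequality of arithmetic and geometric
  means shows that \<open>a\<^sup>2 / k + b\<^sup>2 * k\<close> has the unique minimum \<open>k = a / b\<close>: the projection of a
  half-plane point \<open>W\<close> to the positive axis is \<open>norm W\<close>.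
\<close>

lemma geodesic_projection_eq:
  assumes \<tau>: "norm \<tau> = 1" and z: "norm z < 1"
  shows "geodesic_projection \<tau> z =
    of_real ((norm (\<tau> + z) - norm (\<tau> - z)) / (norm (\<tau> + z) + norm (\<tau> - z))) * \<tau>"
proof -
  define a b where "a = norm (\<tau> + z)" and "b = norm (\<tau> - z)"
  define r0 where "r0 = (a - b) / (a + b)"
  have "z \<noteq> - \<tau>" "z \<noteq> \<tau>" using \<tau> z by auto
  then have ab: "a > 0" "b > 0" by (auto simp: a_def b_def add_eq_0_iff2)
  define M where "M = 1 - (norm z)\<^sup>2"
  have M: "M > 0" using z by (simp add: M_def abs_square_less_1)
  define H where "H r = (1 - r) / (1 + r) * a\<^sup>2 + (1 + r) / (1 - r) * b\<^sup>2" for r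
  have r0: "-1 < r0" "r0 < 1" using ab by (simp_all add: r0_def field_simps)
  have Hr0: "H r0 = 2 * a * b"
  proof -
    have "1 - r0 = 2 * b / (a + b)" "1 + r0 = 2 * a / (a + b)"
      using ab by (simp_all add: r0_def field_simps)
    then have "(1 - r0) / (1 + r0) = b / a" "(1 + r0) / (1 - r0) = a / b"
      using ab by simp_all
    then show ?thesis using ab unfolding H_def by (simp add: power2_eq_square)
  qed
  have H: "H r > 2 * a * b" if "-1 < r" "r < 1" "r \<noteq> r0" for r
  proof -
    have "H r - 2 * a * b = ((1 - r) * a - (1 + r) * b)\<^sup>2 / ((1 + r) * (1 - r))"
      using that by (simp add: H_def divide_simps) (simp add: power2_eq_square algebra_simps)
    moreover have "(1 - r) * a - (1 + r) * b \<noteq> 0"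
      using that(3) ab by (auto simp: r0_def field_simps)
    ultimately have "H r - 2 * a * b > 0" using that by simp
    then show ?thesis by simp
  qed
  have less: "hyperbolic_dist z (of_real r * \<tau>) < hyperbolic_dist z (of_real s * \<tau>) \<longleftrightarrow> H r < H s"
    if "-1 < r" "r < 1" "-1 < s" "s < 1" for r s
  proof -
    have pos: "H r + 2 * M > 0" "H s + 2 * M > 0"
      using that ab M by (auto simp: H_def intro!: add_nonneg_pos add_nonneg_nonneg)
    have "hyperbolic_dist z (of_real r * \<tau>) < hyperbolic_dist z (of_real s * \<tau>) \<longleftrightarrow>
        1 - 4 * M / (H r + 2 * M) < 1 - 4 * M / (H s + 2 * M)"
      using that \<tau> z norm_Moebius_diameter[OF \<tau> z that(1,2)] norm_Moebius_diameter[OF \<tau> z that(3,4)]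
      by (subst hyperbolic_dist_less_iff) (auto simp: norm_mult H_def M_def a_def b_def)
    also have "\<dots> \<longleftrightarrow> H r < H s"
      using pos M by (simp add: divide_less_cancel frac_less2 field_simps)
    finally show ?thesis .
  qed
  have "geodesic_projection \<tau> z = of_real r0 * \<tau>"
    unfolding geodesic_projection_def
  proof (rule the_equality)
    show "is_arg_min (hyperbolic_dist z) (\<lambda>u. u \<in> diameter_geodesic \<tau>) (of_real r0 * \<tau>)"
      unfolding is_arg_min_def diameter_geodesic_def
      using r0 less[of _ r0] Hr0 H by (force simp: not_less)
    fix w assume "is_arg_min (hyperbolic_dist z) (\<lambda>u. u \<in> diameter_geodesic \<tau>) w"
    then obtain r where r: "w = of_real r * \<tau>" "-1 < r" "r < 1"
      and "\<not> hyperbolic_dist z (of_real r0 * \<tau>) < hyperbolic_dist z w"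
      using r0 unfolding is_arg_min_def diameter_geodesic_def by fastforce
    then have "\<not> H r0 < H r" using less r0 by auto
    then have "r = r0" using H[of r] r Hr0 by fastforce
    then show "w = of_real r0 * \<tau>" using r by simp
  qed
  then show ?thesis by (simp add: r0_def a_def b_def)
qed

lemma hyperbolic_dist_geodesic_projection:
  assumes \<tau>: "norm \<tau> = 1" and z: "norm z < 1" and near: "norm (z - \<tau>) \<le> 1"
  shows "hyperbolic_dist 0 (geodesic_projection \<tau> z) = ln (norm (\<tau> + z) / norm (z - \<tau>)) / 2"
proof -
  define a b where "a = norm (\<tau> + z)" and "b = norm (\<tau> - z)"
  have "2 = norm ((\<tau> + z) + (\<tau> - z))" using \<tau> by (simp add: norm_mult flip: mult_2)
  also have "\<dots> \<le> a + b" unfolding a_def b_def by (rule norm_triangle_ineq)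
  finally have "2 \<le> a + b" .
  moreover have b: "0 < b" "b \<le> 1" using \<tau> z near by (auto simp: b_def norm_minus_commute)
  ultimately have ab: "b \<le> a" "a > 0" by linarith+
  have "norm (geodesic_projection \<tau> z) = (a - b) / (a + b)"
    unfolding geodesic_projection_eq[OF \<tau> z] using ab b \<tau> by (simp add: norm_mult norm_divide flip: a_def b_def of_real_diff of_real_add)
  moreover have "(1 + (a - b) / (a + b)) / (1 - (a - b) / (a + b)) = a / b"
    using ab b by (simp add: divide_simps)
  ultimately show ?thesis
    by (simp add: hyperbolic_dist_0 a_def b_def norm_minus_commute)
qed

text \<open>
  Near \<open>\<tau>\<close> the projected distance is, up to a bounded error, half the logarithm of the inverse
  distance to \<open>\<tau>\<close>. This is what makes the estimates for the orthogonal speed equivalent to those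
  for the rate of convergence.
\<close>

lemma geodesic_projection_dist_bounds:
  assumes \<tau>: "norm \<tau> = 1" and z: "norm z < 1" and near: "norm (z - \<tau>) \<le> 1"
  shows "- ln (norm (z - \<tau>)) / 2 \<le> hyperbolic_dist 0 (geodesic_projection \<tau> z)"
    and "hyperbolic_dist 0 (geodesic_projection \<tau> z) \<le> (ln 2 - ln (norm (z - \<tau>))) / 2"
proof -
  have "z \<noteq> \<tau>" using \<tau> z by auto
  have "2 = norm ((\<tau> + z) - (z - \<tau>))" using \<tau> by (simp add: norm_mult flip: mult_2)
  also have "\<dots> \<le> norm (\<tau> + z) + norm (z - \<tau>)" by (rule norm_triangle_ineq4)
  finally have 1: "1 \<le> norm (\<tau> + z)" using near by simp
  have 2: "norm (\<tau> + z) \<le> 2" using norm_triangle_ineq[of \<tau> z] \<tau> z by simp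
  have eq: "hyperbolic_dist 0 (geodesic_projection \<tau> z) = (ln (norm (\<tau> + z)) - ln (norm (z - \<tau>))) / 2"
    unfolding hyperbolic_dist_geodesic_projection[OF assms]
    using 1 \<open>z \<noteq> \<tau>\<close> by (subst ln_div) auto
  show "- ln (norm (z - \<tau>)) / 2 \<le> hyperbolic_dist 0 (geodesic_projection \<tau> z)"
    using 1 by (simp add: eq)
  have "ln (norm (\<tau> + z)) \<le> ln 2" using 1 2 by (subst ln_le_cancel_iff) auto
  then show "hyperbolic_dist 0 (geodesic_projection \<tau> z) \<le> (ln 2 - ln (norm (z - \<tau>))) / 2"
    by (simp add: eq)
qed

section \<open>A holomorphic function with large real part along the orbit\<close>

lemma path_of_convergent_curve:
  fixes \<omega> :: "real \<Rightarrow> 'a::topological_space"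
  assumes cont: "continuous_on {t..} \<omega>" and lim: "(\<omega> \<longlongrightarrow> \<tau>) at_top"
  obtains \<gamma> where "path \<gamma>" "pathstart \<gamma> = \<omega> t" "pathfinish \<gamma> = \<tau>"
    "path_image \<gamma> \<subseteq> insert \<tau> (\<omega> ` {t..})"
proof -
  \<comment> \<open>The curve is traversed backwards, so that the limit point sits at parameter \<open>0\<close>.\<close>
  define \<eta> where "\<eta> x = (if x = 0 then \<tau> else \<omega> (t + (1 / x - 1)))" for x :: real
  have "path \<eta>"
    unfolding path_def continuous_on_eq_continuous_within
  proof
    fix x :: real assume x: "x \<in> {0..1}"
    show "continuous (at x within {0..1}) \<eta>"
    proof (cases "x = 0")
      case True
      have "filterlim (\<lambda>x::real. t + (1 / x - 1)) at_top (at_right 0)"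
        by real_asymp
      then have "filterlim (\<lambda>x::real. t + (1 / x - 1)) at_top (at 0 within {0..1})"
        by (rule filterlim_mono) (auto simp: at_within_Icc_at_right)
      then have "((\<lambda>x. \<omega> (t + (1 / x - 1))) \<longlongrightarrow> \<tau>) (at 0 within {0..1})"
        by (rule filterlim_compose[OF lim])
      then have "(\<eta> \<longlongrightarrow> \<tau>) (at 0 within {0..1})"
        by (rule Lim_transform_eventually) (auto simp: \<eta>_def eventually_at_filter)
      then show ?thesis
        unfolding True continuous_within by (simp add: \<eta>_def)
    next
      case False
      with x have "x > 0" by auto
      have "continuous_on {0<..1} (\<lambda>x. \<omega> (t + (1 / x - 1)))"
        by (rule continuous_on_compose2[OF cont]) (auto intro!: continuous_intros simp: field_simps)
      then have "continuous_on {0<..1} \<eta>"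
        by (rule continuous_on_eq) (auto simp: \<eta>_def)
      then have "continuous (at x within {0<..1}) \<eta>"
        using x \<open>x > 0\<close> by (auto simp: continuous_on_eq_continuous_within)
      moreover have "at x within {0<..1} = at x within {0..1}"
        using \<open>x > 0\<close> by (intro at_within_nhd[of x "{0<..}"]) auto
      ultimately show ?thesis by simp
    qed
  qed
  show ?thesis
  proof (rule that[of "reversepath \<eta>"])
    show "path (reversepath \<eta>)" using \<open>path \<eta>\<close> by simp
    show "pathstart (reversepath \<eta>) = \<omega> t" "pathfinish (reversepath \<eta>) = \<tau>"
      by (simp_all add: pathstart_def pathfinish_def reversepath_def \<eta>_def)
    show "path_image (reversepath \<eta>) \<subseteq> insert \<tau> (\<omega> ` {t..})"
      unfolding path_image_reversepath
      by (auto simp: path_image_def \<eta>_def field_simps intro!: imageI)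
  qed
qed

text \<open>
  The function \<open>z powr \<beta> / \<beta>\<close> has derivative \<open>z powr (- 1 / \<alpha>)\<close>, whose modulus on a vertical line
  with abscissa \<open>u\<close> is at most \<open>u powr (- 1 / \<alpha>)\<close>. In the region the distance to the axis is at
  most \<open>u powr (1 / \<alpha>)\<close>, so on the whole cross-section the function differs by at most \<open>1\<close>
  from its value on the axis.
\<close>

lemma norm_powr_diff_le_1:
  assumes \<alpha>: "\<alpha> > 1" and u: "u > 0" and v: "\<bar>v\<bar> \<le> u powr (1 / \<alpha>)"
  defines "\<beta> \<equiv> 1 - 1 / \<alpha>"
  shows "norm ((Complex u v powr of_real \<beta>) / of_real \<beta> - of_real (u powr \<beta> / \<beta>)) \<le> 1"
proof -
  have \<beta>: "\<beta> > 0" "\<beta> < 1" using \<alpha> by (simp_all add: \<beta>_def)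
  let ?S = "{z. u \<le> Re z}"
  have "norm (Complex u v powr of_real \<beta> / of_real \<beta> - of_real u powr of_real \<beta> / of_real \<beta>)
      \<le> u powr (\<beta> - 1) * norm (Complex u v - of_real u)"
  proof (rule field_differentiable_bound[where S = ?S and f' = "\<lambda>z. z powr of_real (\<beta> - 1)"])
    show "convex ?S" by (rule convex_halfspace_Re_ge)
    fix z assume z: "z \<in> ?S"
    then have "z \<notin> \<real>\<^sub>\<le>\<^sub>0" using u by (auto simp: complex_nonpos_Reals_iff)
    then show "((\<lambda>z. z powr of_real \<beta> / of_real \<beta>) has_field_derivative z powr of_real (\<beta> - 1)) (at z within ?S)"
      using \<beta> by (auto intro!: derivative_eq_intros)
    have "u \<le> norm z" using z complex_Re_le_cmod[of z] by auto
    then have "norm z powr (\<beta> - 1) \<le> u powr (\<beta> - 1)"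
      using u \<beta> by (intro powr_mono2') auto
    then show "norm (z powr of_real (\<beta> - 1)) \<le> u powr (\<beta> - 1)"
      using u \<open>u \<le> norm z\<close> by (simp add: norm_powr_real_powr')
  qed auto
  also have "norm (Complex u v - of_real u) = \<bar>v\<bar>"
    by (simp add: cmod_def)
  also have "u powr (\<beta> - 1) * \<bar>v\<bar> \<le> u powr (\<beta> - 1) * u powr (1 / \<alpha>)"
    using v by (intro mult_left_mono) auto
  also have "\<dots> = 1" using u by (simp add: \<beta>_def flip: powr_add)
  finally show ?thesis using u by (simp add: powr_of_real)
qed

text \<open>
  Since \<open>1 < \<pi> / 2\<close>, the exponential maps the closed unit disc about \<open>x\<close> well inside the right half-plane.
\<close>

lemma Re_exp_ge_of_dist_le_1:
  assumes "norm (w - of_real x) \<le> 1"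
  shows "cos 1 * exp (x - 1) \<le> Re (exp w)"
proof -
  have "\<bar>Re w - x\<bar> \<le> 1" using abs_Re_le_cmod[of "w - of_real x"] assms by simp
  then have 1: "exp (x - 1) \<le> exp (Re w)" by simp
  have "\<bar>Im w\<bar> \<le> 1" using abs_Im_le_cmod[of "w - of_real x"] assms by simp
  then have "cos 1 \<le> cos \<bar>Im w\<bar>" using pi_gt3 by (intro cos_monotone_0_pi_le) auto
  then have 2: "cos 1 \<le> cos (Im w)" by simp
  have "0 < cos (1::real)" using pi_gt3 by (intro cos_gt_zero) auto
  with 1 2 show ?thesis
    by (simp add: Re_exp mult.commute) (intro mult_mono, auto)
qed

lemma disc_semigroup_orbit_continuous:
  assumes "disc_semigroup \<phi>" and "norm z < 1"
  shows "continuous_on {0..} (\<lambda>t. \<phi> t z)"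
  unfolding continuous_on_def
proof
  fix t :: real assume "t \<in> {0..}"
  then have "uniform_limit {z} \<phi> (\<phi> t) (at t within {0..})"
    using assms unfolding disc_semigroup_def by (metis atLeast_iff compact_sing empty_subsetI insert_subset mem_ball_0)
  then show "((\<lambda>t. \<phi> t z) \<longlongrightarrow> \<phi> t z) (at t within {0..})"
    by (rule tendsto_uniform_limitI) simp
qed

lemma disc_semigroup_orbit_in_disc:
  assumes "disc_semigroup \<phi>" "t \<ge> 0" "norm z < 1"
  shows "norm (\<phi> t z) < 1"
  using assms by (force simp: disc_semigroup_def image_subset_iff)

section \<open>The two estimates for the rate of convergence\<close>

text \<open>
  With \<open>\<beta> = 1 - 1 / \<alpha>\<close>, put \<open>q = exp ((- \<i> * (h - p)) powr \<beta> / \<beta>)\<close>. By the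
  width of the region, \<open>q\<close> has positive real part,
  which on the orbit after time \<open>t\<close> is at least a constant times \<open>exp (t powr \<beta> / \<beta>)\<close>. The orbit
  after time \<open>t\<close> is a path from \<open>\<phi> t 0\<close> to \<open>\<tau>\<close>, so the barrier lemma bounds the product of
  \<open>exp (t powr \<beta> / \<beta>)\<close> and \<open>norm (\<phi> t 0 - \<tau>)\<close>.
\<close>

lemma rate_upper_bound:
  assumes sg: "disc_semigroup \<phi>" and dw: "denjoy_wolff_point \<phi> \<tau>" and k: "koenigs_function \<phi> h"
    and \<alpha>: "\<alpha> > 1" and sub: "h ` ball 0 1 \<subseteq> (\<lambda>z. p + z) ` Pi_region \<alpha>"
  shows "\<exists>K>0. \<forall>t\<ge>0. norm (\<phi> t 0 - \<tau>) \<le> K * exp (- (\<alpha> / (\<alpha> - 1) * t powr (1 - 1 / \<alpha>)))"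
proof -
  define \<beta> where "\<beta> = 1 - 1 / \<alpha>"
  have \<beta>: "\<beta> > 0" and \<beta>i: "\<alpha> / (\<alpha> - 1) = 1 / \<beta>"
    using \<alpha> by (simp_all add: \<beta>_def field_simps)
  have \<tau>: "norm \<tau> = 1" using dw by (simp add: denjoy_wolff_point_def)
  have holh: "h holomorphic_on ball 0 1"
    and hk: "\<And>t. t \<ge> 0 \<Longrightarrow> h (\<phi> t 0) = h 0 + \<i> * of_real t"
    using k by (simp_all add: koenigs_function_def)
  define u v where "u z = Im (h z - p)" and "v z = - Re (h z - p)" for z
  have uv: "u z > 0" "\<bar>v z\<bar> \<le> u z powr (1 / \<alpha>)" if "norm z < 1" for z
  proof -
    have "h z - p \<in> Pi_region \<alpha>" using sub that by (force simp: image_subset_iff)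
    then have *: "\<bar>v z\<bar> powr \<alpha> < u z" by (simp add: Pi_region_def u_def v_def abs_minus_commute)
    then show "u z > 0" using powr_ge_zero[of "\<bar>v z\<bar>" \<alpha>] by linarith
    have "(\<bar>v z\<bar> powr \<alpha>) powr (1 / \<alpha>) \<le> u z powr (1 / \<alpha>)"
      using * \<alpha> by (intro powr_mono2) auto
    then show "\<bar>v z\<bar> \<le> u z powr (1 / \<alpha>)" using \<alpha> by (simp add: powr_powr)
  qed
  have Cuv: "Complex (u z) (v z) = - \<i> * (h z - p)" for z
    by (simp add: complex_eq_iff u_def v_def)
  define q where "q z = exp ((- \<i> * (h z - p)) powr of_real \<beta> / of_real \<beta>)" for z
  have q: "cos 1 * exp (u z powr \<beta> / \<beta> - 1) \<le> Re (q z)" if "norm z < 1" for z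
    unfolding q_def Cuv[symmetric] \<beta>_def
    by (intro Re_exp_ge_of_dist_le_1 norm_powr_diff_le_1 \<alpha> uv that)
  have cos1: "cos (1::real) > 0" using pi_gt3 by (intro cos_gt_zero) auto
  have qpos: "Re (q z) > 0" if "norm z < 1" for z
    by (rule less_le_trans[OF mult_pos_pos[OF cos1 exp_gt_zero] q[OF that]])
  have holq: "q holomorphic_on ball 0 1"
  proof -
    have "- \<i> * (h z - p) \<notin> \<real>\<^sub>\<le>\<^sub>0" if "z \<in> ball 0 1" for z
      using uv(1)[of z] that unfolding Cuv[symmetric] by (auto simp: complex_nonpos_Reals_iff)
    then show ?thesis
      unfolding q_def using \<beta> by (intro holomorphic_intros holh) auto
  qed
  define c where "c = cos (1::real) * exp (- 1)"
  have c: "c > 0" using cos1 by (simp add: c_def)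
  have bound: "c * exp (t powr \<beta> / \<beta>) * norm (\<phi> t 0 - \<tau>) \<le> 68 * Re (q 0)" if t: "t \<ge> 0" for t
  proof -
    have "continuous_on {t..} (\<lambda>s. \<phi> s 0)"
      using disc_semigroup_orbit_continuous[OF sg, of 0] t by (auto intro: continuous_on_subset)
    moreover have "((\<lambda>s. \<phi> s 0) \<longlongrightarrow> \<tau>) at_top"
      using dw by (simp add: denjoy_wolff_point_def)
    ultimately obtain \<gamma> where \<gamma>: "path \<gamma>" "pathstart \<gamma> = \<phi> t 0" "pathfinish \<gamma> = \<tau>"
        "path_image \<gamma> \<subseteq> insert \<tau> ((\<lambda>s. \<phi> s 0) ` {t..})"
      by (rule path_of_convergent_curve)
    have D: "norm (\<phi> s 0) < 1" if "s \<ge> t" for s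
      using disc_semigroup_orbit_in_disc[OF sg, of s 0] that t by simp
    show ?thesis
    proof (rule path_barrier[OF holq _ \<tau> \<gamma>(1,3)])
      show "path_image \<gamma> \<subseteq> insert \<tau> (ball 0 1)" using \<gamma>(4) D by auto
      show "\<phi> t 0 \<in> path_image \<gamma>" using \<gamma>(2) pathstart_in_path_image by metis
      show "0 < c * exp (t powr \<beta> / \<beta>)" using c by simp
      fix z assume "z \<in> path_image \<gamma> - {\<tau>}"
      then obtain s where s: "s \<ge> t" "z = \<phi> s 0" using \<gamma>(4) by auto
      have "u z = u 0 + s" using hk[of s] s t by (simp add: u_def)
      then have "t powr \<beta> \<le> u z powr \<beta>"
        using uv(1)[of 0] s t \<beta> by (intro powr_mono2) auto
      then have "exp (t powr \<beta> / \<beta> - 1) \<le> exp (u z powr \<beta> / \<beta> - 1)"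
        using \<beta> by (simp add: divide_right_mono)
      then have "cos 1 * exp (t powr \<beta> / \<beta> - 1) \<le> cos 1 * exp (u z powr \<beta> / \<beta> - 1)"
        using cos1 by (intro mult_left_mono) auto
      also have "\<dots> \<le> Re (q z)" using D s by (intro q) auto
      finally show "c * exp (t powr \<beta> / \<beta>) \<le> Re (q z)"
        by (simp add: c_def exp_diff exp_minus field_simps)
    qed (use qpos in auto)
  qed
  define K where "K = 68 * Re (q 0) / c"
  have "norm (\<phi> t 0 - \<tau>) \<le> K * exp (- (\<alpha> / (\<alpha> - 1) * t powr (1 - 1 / \<alpha>)))" if "t \<ge> 0" for t
    using bound[OF that] c unfolding \<beta>i \<beta>_def[symmetric] by (simp add: K_def exp_minus field_simps)
  moreover have "K > 0" using qpos[of 0] c by (simp add: K_def)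
  ultimately show ?thesis by blast
qed

text \<open>
  At height \<open>s\<close> the boundary curve is at horizontal distance \<open>s powr (1 / \<alpha>)\<close> from the axis and is
  nearly vertical, so a disc of slightly smaller radius fits, even if its centre is off the axis by
  a bounded amount. After division by \<open>s\<close> the required inequality reads \<open>(1 / (1 + \<epsilon>)) powr \<alpha> < 1\<close>
  in the limit.
\<close>

lemma eventually_ball_subset_translated_Pi_region:
  assumes \<alpha>: "\<alpha> > 1" and \<epsilon>: "\<epsilon> > 0"
  shows "\<forall>\<^sub>F s in at_top. ball (w + \<i> * of_real s) (s powr (1 / \<alpha>) / (1 + \<epsilon>)) \<subseteq> Pi_region \<alpha>"
proof -
  define r where "r s = s powr (1 / \<alpha>) / (1 + \<epsilon>)" for s
  have neg: "((\<lambda>s::real. s powr (- c)) \<longlongrightarrow> 0) at_top" if "c > 0" for c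
    using that by real_asymp
  have "((\<lambda>s. (\<bar>Re w\<bar> * s powr (- (1 / \<alpha>)) + 1 / (1 + \<epsilon>)) powr \<alpha>) \<longlongrightarrow>
      (\<bar>Re w\<bar> * 0 + 1 / (1 + \<epsilon>)) powr \<alpha>) at_top"
    using \<alpha> \<epsilon> by (intro tendsto_intros neg) auto
  moreover have "((\<lambda>s. Im w * s powr (- 1) + 1 - s powr (- (1 - 1 / \<alpha>)) / (1 + \<epsilon>)) \<longlongrightarrow>
      Im w * 0 + 1 - 0 / (1 + \<epsilon>)) at_top"
    using \<alpha> \<epsilon> by (intro tendsto_intros neg) (auto simp: field_simps)
  moreover have "(\<bar>Re w\<bar> * 0 + 1 / (1 + \<epsilon>)) powr \<alpha> < Im w * 0 + 1 - 0 / (1 + \<epsilon>)"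
    using \<alpha> \<epsilon> powr_less_mono2[of \<alpha> "1 / (1 + \<epsilon>)" 1] by simp
  ultimately have "\<forall>\<^sub>F s in at_top. 0 < (Im w * s powr (- 1) + 1 - s powr (- (1 - 1 / \<alpha>)) / (1 + \<epsilon>))
      - (\<bar>Re w\<bar> * s powr (- (1 / \<alpha>)) + 1 / (1 + \<epsilon>)) powr \<alpha>"
    by (intro order_tendstoD(1)[OF tendsto_diff]) simp_all
  with eventually_gt_at_top[of 0] show ?thesis
  proof eventually_elim
    case (elim s)
    have "\<bar>Re w\<bar> + r s = s powr (1 / \<alpha>) * (\<bar>Re w\<bar> * s powr (- (1 / \<alpha>)) + 1 / (1 + \<epsilon>))"
      using elim(1) by (simp add: r_def distrib_left mult.left_commute flip: powr_add)
    then have "(\<bar>Re w\<bar> + r s) powr \<alpha> = s * (\<bar>Re w\<bar> * s powr (- (1 / \<alpha>)) + 1 / (1 + \<epsilon>)) powr \<alpha>"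
      using elim(1) \<alpha> \<epsilon> by (simp add: powr_mult powr_powr)
    also have "\<dots> < s * (Im w * s powr (- 1) + 1 - s powr (- (1 - 1 / \<alpha>)) / (1 + \<epsilon>))"
      using elim by (intro mult_strict_left_mono) auto
    also have "\<dots> = Im w + s - r s"
      using elim(1) powr_mult_base[of s "- 1"] powr_mult_base[of s "- (1 - 1 / \<alpha>)"]
      by (simp add: r_def algebra_simps)
    finally have *: "(\<bar>Re w\<bar> + r s) powr \<alpha> < Im w + s - r s" .
    show "ball (w + \<i> * of_real s) (s powr (1 / \<alpha>) / (1 + \<epsilon>)) \<subseteq> Pi_region \<alpha>"
    proof
      fix z assume "z \<in> ball (w + \<i> * of_real s) (s powr (1 / \<alpha>) / (1 + \<epsilon>))"
      then have z: "norm (z - (w + \<i> * of_real s)) < r s"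
        by (simp add: r_def dist_norm norm_minus_commute)
      have "\<bar>Re z - Re w\<bar> < r s" "\<bar>Im z - (Im w + s)\<bar> < r s"
        using abs_Re_le_cmod[of "z - (w + \<i> * of_real s)"] abs_Im_le_cmod[of "z - (w + \<i> * of_real s)"] z
        by simp_all
      then have 1: "\<bar>Re z\<bar> \<le> \<bar>Re w\<bar> + r s" and 2: "Im w + s - r s < Im z" by linarith+
      have "\<bar>Re z\<bar> powr \<alpha> \<le> (\<bar>Re w\<bar> + r s) powr \<alpha>"
        using 1 \<alpha> by (intro powr_mono2) auto
      then show "z \<in> Pi_region \<alpha>" using * 2 by (simp add: Pi_region_def)
    qed
  qed
qed

text \<open>
  With \<open>g\<close> the inverse of \<open>h\<close>, the orbit is \<open>z s = g (h 0 + \<i> * s)\<close>. The Schwarz-Pick inequality on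
  a disc of radius \<open>r s\<close> in the image of \<open>h\<close> bounds its velocity by \<open>u s / r s\<close>, where
  \<open>u s = 1 - (norm (z s))\<^sup>2\<close>; hence the logarithmic derivative of \<open>u\<close> is at least \<open>- 2 / r s\<close>, that is
  \<open>- 2 * (1 + \<epsilon>) * s powr (- 1 / \<alpha>)\<close>. Integration bounds \<open>u\<close> from below, and \<open>u\<close> is at most twice the
  distance to \<open>\<tau>\<close>.
\<close>

lemma rate_lower_bound:
  assumes sg: "disc_semigroup \<phi>" and dw: "denjoy_wolff_point \<phi> \<tau>" and k: "koenigs_function \<phi> h"
    and \<alpha>: "\<alpha> > 1" and sub: "(\<lambda>z. p + z) ` Pi_region \<alpha> \<subseteq> h ` ball 0 1" and \<epsilon>: "\<epsilon> > 0"
  shows "\<exists>K>0. \<forall>t\<ge>0. norm (\<phi> t 0 - \<tau>) \<ge> K * exp (- (2 * (1 + \<epsilon>) * \<alpha> / (\<alpha> - 1) * t powr (1 - 1 / \<alpha>)))"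
proof -
  define \<beta> where "\<beta> = 1 - 1 / \<alpha>"
  have \<beta>: "\<beta> > 0" and \<beta>i: "2 * (1 + \<epsilon>) * \<alpha> / (\<alpha> - 1) = 2 * (1 + \<epsilon>) / \<beta>"
    using \<alpha> by (simp_all add: \<beta>_def field_simps)
  have \<tau>: "norm \<tau> = 1" using dw by (simp add: denjoy_wolff_point_def)
  have holh: "h holomorphic_on ball 0 1" and injh: "inj_on h (ball 0 1)"
    and hk: "\<And>t. t \<ge> 0 \<Longrightarrow> h (\<phi> t 0) = h 0 + \<i> * of_real t"
    using k by (simp_all add: koenigs_function_def)
  obtain g where holg: "g holomorphic_on h ` ball 0 1" and gh: "\<And>z. z \<in> ball 0 1 \<Longrightarrow> g (h z) = z"
    using holomorphic_has_inverse[OF holh open_ball injh] by metis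
  have gD: "norm (g w) < 1" if "w \<in> h ` ball 0 1" for w
    using that gh by auto
  define z where "z s = g (h 0 + \<i> * of_real s)" for s
  have z\<phi>: "z s = \<phi> s 0" and zD: "norm (z s) < 1" if "s \<ge> 0" for s
  proof -
    have *: "\<phi> s 0 \<in> ball 0 1" using disc_semigroup_orbit_in_disc[OF sg that, of 0] by simp
    then show "z s = \<phi> s 0" using gh[OF *] hk[OF that] by (simp add: z_def)
    then show "norm (z s) < 1" using * by simp
  qed
  define r where "r s = s powr (1 / \<alpha>) / (1 + \<epsilon>)" for s
  obtain s0 where s0: "s0 > 0" "\<And>s. s \<ge> s0 \<Longrightarrow> ball (h 0 - p + \<i> * of_real s) (r s) \<subseteq> Pi_region \<alpha>"
    using eventually_conj[OF eventually_ball_subset_translated_Pi_region[OF \<alpha> \<epsilon>, of "h 0 - p"] eventually_gt_at_top[of 0]]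
    unfolding eventually_at_top_linorder r_def by (meson order.refl)
  have ball: "ball (h 0 + \<i> * of_real s) (r s) \<subseteq> h ` ball 0 1" if "s \<ge> s0" for s
  proof
    fix y assume "y \<in> ball (h 0 + \<i> * of_real s) (r s)"
    then have "y - p \<in> ball (h 0 - p + \<i> * of_real s) (r s)"
      by (simp add: dist_norm algebra_simps)
    then have "y - p \<in> Pi_region \<alpha>" using s0(2)[OF that] by blast
    then have "p + (y - p) \<in> h ` ball 0 1" using sub by blast
    then show "y \<in> h ` ball 0 1" by simp
  qed
  define u where "u s = 1 - z s \<bullet> z s" for s
  define L where "L s = ln (u s) + 2 * (1 + \<epsilon>) / \<beta> * s powr \<beta>" for s
  have upos: "u s > 0" if "s \<ge> 0" for s
    using zD[OF that] by (simp add: u_def abs_square_less_1 flip: power2_norm_eq_inner)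
  \<comment> \<open>\<open>L\<close> is increasing; this is the integrated form of the differential inequality for \<open>u\<close>.\<close>
  have dL: "\<exists>D. (L has_real_derivative D) (at s) \<and> D \<ge> 0" if "s \<ge> s0" for s
  proof -
    have s: "s > 0" using s0 that by simp
    have r: "r s > 0" using s \<epsilon> by (simp add: r_def)
    define D where "D = deriv g (h 0 + \<i> * of_real s)"
    have hb: "g holomorphic_on ball (h 0 + \<i> * of_real s) (r s)"
      using holg ball[OF that] by (rule holomorphic_on_subset)
    have "(g has_field_derivative D) (at (h 0 + \<i> * of_real s))"
      unfolding D_def using r by (intro holomorphic_derivI[OF hb]) auto
    then have "((g \<circ> (\<lambda>s. h 0 + \<i> * of_real s)) has_vector_derivative \<i> * D) (at s)"
      by (intro field_vector_diff_chain_at) (auto intro!: derivative_eq_intros)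
    then have zd: "(z has_vector_derivative \<i> * D) (at s)"
      by (simp add: z_def[abs_def] o_def)
    have "((\<lambda>s. z s \<bullet> z s) has_vector_derivative z s \<bullet> (\<i> * D) + (\<i> * D) \<bullet> z s) (at s)"
      by (rule bounded_bilinear.has_vector_derivative[OF bounded_bilinear_inner zd zd])
    then have ud: "(u has_real_derivative - (2 * (z s \<bullet> (\<i> * D)))) (at s)"
      unfolding u_def[abs_def] has_real_derivative_iff_has_vector_derivative
      by (auto intro!: derivative_eq_intros simp: inner_commute)
    have "(L has_real_derivative - (2 * (z s \<bullet> (\<i> * D))) / u s + 2 * (1 + \<epsilon>) * s powr (\<beta> - 1)) (at s)"
      unfolding L_def[abs_def] using s upos[of s] \<beta>
      by (auto intro!: derivative_eq_intros ud)
    moreover have "- (2 * (z s \<bullet> (\<i> * D))) / u s + 2 * (1 + \<epsilon>) * s powr (\<beta> - 1) \<ge> 0"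
    proof -
      have "z s \<bullet> (\<i> * D) \<le> norm (z s) * norm D"
        using norm_cauchy_schwarz[of "z s" "\<i> * D"] by (simp add: norm_mult)
      also have "\<dots> \<le> 1 * norm D" using zD[of s] s by (intro mult_right_mono) auto
      also have "r s * norm D \<le> u s"
        unfolding u_def z_def D_def power2_norm_eq_inner[symmetric]
        by (rule Schwarz_Pick_deriv[OF hb r gD]) (use ball[OF that] in blast)
      then have "1 * norm D \<le> u s / r s" using r by (simp add: field_simps)
      finally have "z s \<bullet> (\<i> * D) / u s \<le> 1 / r s"
        using upos[of s] s by (simp add: divide_le_eq)
      also have "1 / r s = (1 + \<epsilon>) * s powr (\<beta> - 1)"
        using \<epsilon> s by (simp add: r_def \<beta>_def powr_minus field_simps)
      finally have "2 * (z s \<bullet> (\<i> * D) / u s) \<le> 2 * ((1 + \<epsilon>) * s powr (\<beta> - 1))"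
        by (rule mult_left_mono) simp
      moreover have "- (2 * (z s \<bullet> (\<i> * D))) / u s + 2 * (1 + \<epsilon>) * s powr (\<beta> - 1) =
          2 * ((1 + \<epsilon>) * s powr (\<beta> - 1)) - 2 * (z s \<bullet> (\<i> * D) / u s)"
        by (simp add: algebra_simps)
      ultimately show ?thesis by (simp only: diff_ge_0_iff_ge)
    qed
    ultimately show ?thesis by blast
  qed
  have late: "exp (L s0) / 2 * exp (- (2 * (1 + \<epsilon>) / \<beta> * t powr \<beta>)) \<le> norm (\<phi> t 0 - \<tau>)" if t: "t \<ge> s0" for t
  proof -
    have "L s0 \<le> L t"
      by (rule DERIV_nonneg_imp_nondecreasing[OF t]) (use dL in auto)
    then have "L s0 - 2 * (1 + \<epsilon>) / \<beta> * t powr \<beta> \<le> ln (u t)"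
      by (simp add: L_def)
    then have "exp (L s0 - 2 * (1 + \<epsilon>) / \<beta> * t powr \<beta>) \<le> u t"
      using upos[of t] s0 t by (simp add: ln_ge_iff)
    also have "u t = (1 - norm (z t)) * (1 + norm (z t))"
      by (simp add: u_def dot_square_norm power2_eq_square algebra_simps)
    also have "\<dots> \<le> (1 - norm (z t)) * 2"
      using zD[of t] s0 t by (intro mult_left_mono) auto
    also have "1 - norm (z t) \<le> norm (\<phi> t 0 - \<tau>)"
      using norm_triangle_ineq2[of \<tau> "z t"] z\<phi>[of t] s0 t \<tau> by (simp add: norm_minus_commute)
    finally show ?thesis by (simp add: exp_diff exp_minus field_simps)
  qed
  \<comment> \<open>Up to time \<open>s0\<close>, compactness gives a positive lower bound.\<close>
  have "continuous_on {0..s0} (\<lambda>t. norm (\<phi> t 0 - \<tau>))"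
    using disc_semigroup_orbit_continuous[OF sg, of 0]
    by (intro continuous_intros) (auto intro: continuous_on_subset)
  then obtain t0 where t0: "t0 \<in> {0..s0}" "\<And>t. t \<in> {0..s0} \<Longrightarrow> norm (\<phi> t0 0 - \<tau>) \<le> norm (\<phi> t 0 - \<tau>)"
    using continuous_attains_inf[of "{0..s0}" "\<lambda>t. norm (\<phi> t 0 - \<tau>)"] s0(1) by auto
  define m where "m = norm (\<phi> t0 0 - \<tau>)"
  have m: "m > 0" using disc_semigroup_orbit_in_disc[OF sg, of t0 0] t0(1) \<tau> by (auto simp: m_def)
  define K where "K = min m (exp (L s0) / 2)"
  have "K * exp (- (2 * (1 + \<epsilon>) / \<beta> * t powr \<beta>)) \<le> norm (\<phi> t 0 - \<tau>)" if "t \<ge> 0" for t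
  proof (cases "t \<le> s0")
    case True
    have "K * exp (- (2 * (1 + \<epsilon>) / \<beta> * t powr \<beta>)) \<le> m * 1"
      using \<epsilon> \<beta> m by (intro mult_mono) (auto simp: K_def)
    then show ?thesis using t0(2)[of t] True that by (simp add: m_def)
  next
    case False
    have "K * exp (- (2 * (1 + \<epsilon>) / \<beta> * t powr \<beta>)) \<le> exp (L s0) / 2 * exp (- (2 * (1 + \<epsilon>) / \<beta> * t powr \<beta>))"
      by (intro mult_right_mono) (auto simp: K_def)
    then show ?thesis using late[of t] False by linarith
  qed
  moreover have "K > 0" using m by (simp add: K_def)
  ultimately show ?thesis unfolding \<beta>i \<beta>_def[symmetric] by blast
qed

section \<open>Orthogonal speed\<close>

lemma eventually_orthogonal_speed_bounds:
  assumes sg: "disc_semigroup \<phi>" and dw: "denjoy_wolff_point \<phi> \<tau>"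
  shows "\<forall>\<^sub>F t in at_top. - ln (norm (\<phi> t 0 - \<tau>)) / 2 \<le> orthogonal_speed \<phi> \<tau> t \<and>
    orthogonal_speed \<phi> \<tau> t \<le> (ln 2 - ln (norm (\<phi> t 0 - \<tau>))) / 2 \<and> norm (\<phi> t 0 - \<tau>) > 0"
proof -
  have \<tau>: "norm \<tau> = 1" and lim: "((\<lambda>t. \<phi> t 0) \<longlongrightarrow> \<tau>) at_top"
    using dw by (simp_all add: denjoy_wolff_point_def)
  have "\<forall>\<^sub>F t in at_top. dist (\<phi> t 0) \<tau> < 1"
    using lim by (rule tendstoD) simp
  with eventually_ge_at_top[of 0] show ?thesis
  proof eventually_elim
    case (elim t)
    have "norm (\<phi> t 0) < 1" using disc_semigroup_orbit_in_disc[OF sg, of t 0] elim by simp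
    then show ?case
      using geodesic_projection_dist_bounds[OF \<tau>, of "\<phi> t 0"] elim \<tau>
      by (auto simp: orthogonal_speed_def dist_norm)
  qed
qed

theorem proposition7p3:
  fixes \<phi> :: "real \<Rightarrow> complex \<Rightarrow> complex" and \<tau> :: complex and h :: "complex \<Rightarrow> complex"
  assumes "disc_semigroup \<phi>"
    and "non_elliptic \<phi>"
    and "denjoy_wolff_point \<phi> \<tau>"
    and "koenigs_function \<phi> h"
  shows "(\<forall>(\<alpha>::real) (p::complex). \<alpha> > 1 \<and> h ` ball 0 1 \<subseteq> (\<lambda>z. p + z) ` Pi_region \<alpha> \<longrightarrow>
            Liminf at_top (\<lambda>t::real. ereal (orthogonal_speed \<phi> \<tau> t
               - \<alpha> / (2 * (\<alpha> - 1)) * t powr (1 - 1 / \<alpha>))) > -\<infinity> \<and>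
            (\<exists>K>0. \<forall>t\<ge>0. norm (\<phi> t 0 - \<tau>)
               \<le> K * exp (- (\<alpha> / (\<alpha> - 1) * t powr (1 - 1 / \<alpha>)))))
       \<and> (\<forall>(\<alpha>::real) (p::complex). \<alpha> > 1 \<and> (\<lambda>z. p + z) ` Pi_region \<alpha> \<subseteq> h ` ball 0 1 \<longrightarrow>
            (\<forall>\<epsilon>>0.
              Limsup at_top (\<lambda>t::real. ereal (orthogonal_speed \<phi> \<tau> t
                 - (1 + \<epsilon>) * \<alpha> / (\<alpha> - 1) * t powr (1 - 1 / \<alpha>))) < \<infinity> \<and>
              (\<exists>K>0. \<forall>t\<ge>0. norm (\<phi> t 0 - \<tau>)
                 \<ge> K * exp (- (2 * (1 + \<epsilon>) * \<alpha> / (\<alpha> - 1) * t powr (1 - 1 / \<alpha>))))))"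
proof (intro conjI allI impI; elim conjE)
  note sg = assms(1) and dw = assms(3) and k = assms(4)
  note speed = eventually_orthogonal_speed_bounds[OF sg dw]
  fix \<alpha> :: real and p :: complex
  assume \<alpha>: "\<alpha> > 1"
  {
    assume sub: "h ` ball 0 1 \<subseteq> (\<lambda>z. p + z) ` Pi_region \<alpha>"
    show upper: "\<exists>K>0. \<forall>t\<ge>0. norm (\<phi> t 0 - \<tau>) \<le> K * exp (- (\<alpha> / (\<alpha> - 1) * t powr (1 - 1 / \<alpha>)))"
      by (rule rate_upper_bound[OF sg dw k \<alpha> sub])
    then obtain K where K: "K > 0" "\<And>t. t \<ge> 0 \<Longrightarrow>
        norm (\<phi> t 0 - \<tau>) \<le> K * exp (- (\<alpha> / (\<alpha> - 1) * t powr (1 - 1 / \<alpha>)))" by blast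
    have "\<forall>\<^sub>F t in at_top. ereal (- ln K / 2) \<le> ereal (orthogonal_speed \<phi> \<tau> t
        - \<alpha> / (2 * (\<alpha> - 1)) * t powr (1 - 1 / \<alpha>))"
      using speed eventually_ge_at_top[of 0]
    proof eventually_elim
      case (elim t)
      have "ln (norm (\<phi> t 0 - \<tau>)) \<le> ln (K * exp (- (\<alpha> / (\<alpha> - 1) * t powr (1 - 1 / \<alpha>))))"
        using K elim by (subst ln_le_cancel_iff) auto
      also have "\<dots> = ln K - \<alpha> / (\<alpha> - 1) * t powr (1 - 1 / \<alpha>)"
        using K(1) by (simp add: ln_mult)
      also have "\<alpha> / (\<alpha> - 1) * t powr (1 - 1 / \<alpha>) = 2 * (\<alpha> / (2 * (\<alpha> - 1)) * t powr (1 - 1 / \<alpha>))"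
        using \<alpha> by (simp add: field_simps)
      finally have "- ln K / 2 \<le> orthogonal_speed \<phi> \<tau> t - \<alpha> / (2 * (\<alpha> - 1)) * t powr (1 - 1 / \<alpha>)"
        using elim by linarith
      then show ?case by (simp only: ereal_less_eq)
    qed
    then have "ereal (- ln K / 2) \<le> Liminf at_top (\<lambda>t::real. ereal (orthogonal_speed \<phi> \<tau> t
        - \<alpha> / (2 * (\<alpha> - 1)) * t powr (1 - 1 / \<alpha>)))"
      by (rule Liminf_bounded)
    then show "Liminf at_top (\<lambda>t::real. ereal (orthogonal_speed \<phi> \<tau> t
        - \<alpha> / (2 * (\<alpha> - 1)) * t powr (1 - 1 / \<alpha>))) > -\<infinity>"
      using ereal_infty_less(2) less_le_trans by fastforce
  next
    fix \<epsilon> :: real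
    assume sub: "(\<lambda>z. p + z) ` Pi_region \<alpha> \<subseteq> h ` ball 0 1" and \<epsilon>: "\<epsilon> > 0"
    show lower: "\<exists>K>0. \<forall>t\<ge>0. norm (\<phi> t 0 - \<tau>)
        \<ge> K * exp (- (2 * (1 + \<epsilon>) * \<alpha> / (\<alpha> - 1) * t powr (1 - 1 / \<alpha>)))"
      by (rule rate_lower_bound[OF sg dw k \<alpha> sub \<epsilon>])
    then obtain K where K: "K > 0" "\<And>t. t \<ge> 0 \<Longrightarrow> norm (\<phi> t 0 - \<tau>)
        \<ge> K * exp (- (2 * (1 + \<epsilon>) * \<alpha> / (\<alpha> - 1) * t powr (1 - 1 / \<alpha>)))" by blast
    have "\<forall>\<^sub>F t in at_top. ereal (orthogonal_speed \<phi> \<tau> t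
        - (1 + \<epsilon>) * \<alpha> / (\<alpha> - 1) * t powr (1 - 1 / \<alpha>)) \<le> ereal ((ln 2 - ln K) / 2)"
      using speed eventually_ge_at_top[of 0]
    proof eventually_elim
      case (elim t)
      define X where "X = (1 + \<epsilon>) * \<alpha> / (\<alpha> - 1) * t powr (1 - 1 / \<alpha>)"
      have "2 * (1 + \<epsilon>) * \<alpha> / (\<alpha> - 1) * t powr (1 - 1 / \<alpha>) = 2 * X"
        by (simp add: X_def)
      then have "K * exp (- (2 * X)) \<le> norm (\<phi> t 0 - \<tau>)"
        using K(2)[of t] elim by simp
      then have "ln (K * exp (- (2 * X))) \<le> ln (norm (\<phi> t 0 - \<tau>))"
        using K(1) elim by (subst ln_le_cancel_iff) auto
      then have "ln K - 2 * X \<le> ln (norm (\<phi> t 0 - \<tau>))"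
        using K(1) by (simp add: ln_mult)
      then have "orthogonal_speed \<phi> \<tau> t - (1 + \<epsilon>) * \<alpha> / (\<alpha> - 1) * t powr (1 - 1 / \<alpha>) \<le> (ln 2 - ln K) / 2"
        using conjunct1[OF conjunct2[OF elim(1)]] unfolding X_def[symmetric] by (simp add: field_simps)
      then show ?case by (simp only: ereal_less_eq)
    qed
    then have "Limsup at_top (\<lambda>t::real. ereal (orthogonal_speed \<phi> \<tau> t
        - (1 + \<epsilon>) * \<alpha> / (\<alpha> - 1) * t powr (1 - 1 / \<alpha>))) \<le> ereal ((ln 2 - ln K) / 2)"
      by (rule Limsup_bounded)
    then show "Limsup at_top (\<lambda>t::real. ereal (orthogonal_speed \<phi> \<tau> t
        - (1 + \<epsilon>) * \<alpha> / (\<alpha> - 1) * t powr (1 - 1 / \<alpha>))) < \<infinity>"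
      using ereal_infty_less(1) le_less_trans by fastforce
  }
qed

end
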